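(* For each of the following pairs $\mathcal{P}/\mathcal{P}'$ of polytopes in $\mathbb{R}^3$, let $\gamma$ be a geodesic cycle on $\mathbb{S}^2$ induced by the edges of $\mathcal{P}$ and let $X\subseteq\mathbb{S}^2$ be the set of vertices of $\mathcal{P}'$ projected onto the sphere. Then $(\gamma,X)$ is a hybrid $s$-design on $\mathbb{S}^2$ with balancing factor $\beta$, where: (i) cuboctahedron / rhombic dodecahedron: $s=5$, $\beta=\frac{21}{25}$; (ii) cuboctahedron / octahedron: $s=5$, $\beta=\frac15$; (iii) icosidodecahedron / rhombic triacontahedron: $s=9$, $\beta=\frac{45}{49}$; (iv) icosidodecahedron / icosahedron: $s=9$, $\beta=\frac{5}{21}$.
   Context: $\mathbb{S}^2$ is the unit sphere in $\mathbb{R}^3$; $\int_{\mathbb{S}^2}$ is with respect to the normalized rotation-invariant measure; $\mathrm{Pol}_{\le s}$ is the space of real polynomials of total degree at most $s$ in $3$ variables restricted to $\mathbb{S}^2$. For $x,y\in\mathbb{S}^2$, $y\ne\pm x$, the geodesic arc between them is the shortest great-circle arc. A geodesic cycle $\gamma$ is a closed chain of finitely many geodesic arcs; $\int_\gamma p$ is the sum of the arc-length integrals over the arcs and $\ell(\gamma)=\int_\gamma1$. The geodesic cycle induced by the edges of a polytope (all of whose vertices have even degree, as is the case here) is the radial projection onto the sphere of any Euler cycle of its edge graph, i.e. a closed walk traversing each edge exactly once. Hybrid design: $(\gamma,X)$ is a hybrid $s$-design with balancing factor $\beta\in[0,1]$ if $\frac{\beta}{|X|}\sum_{x\in X}p(x)+\frac{1-\beta}{\ell(\gamma)}\int_\gamma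 p=\int_{\mathbb{S}^2}p$ for all $p\in\mathrm{Pol}_{\le s}$. Realizations of the polytopes, with vertices projected to $\mathbb{S}^2$ and $\phi=\frac{1+\sqrt5}{2}$: - Cuboctahedron: vertices all permutations of $\frac1{\sqrt2}(\pm1,\pm1,0)$; edges are the pairs with inner product $\frac12$. - Octahedron: vertices $\pm e_1,\pm e_2,\pm e_3$. - Rhombic dodecahedron: projected vertices are the $8$ points $\frac1{\sqrt3}(\pm1,\pm1,\pm1)$ together with the $6$ points $\pm e_1,\pm e_2,\pm e_3$. - Icosidodecahedron: vertices $\pm e_1,\pm e_2,\pm e_3$ and all even permutations of $\frac12(\pm\phi,\pm\phi^{-1},\pm1)$; edges are the pairs with inner product $\frac{\phi}{2}$. - Icosahedron: vertices all even (cyclic) permutations of $\frac{1}{\sqrt{1+\phi^2}}(\pm\phi,\pm1,0)$. - Rhombic triacontahedron: projected vertices are the $12$ icosahedron vertices above together with the $20$ dodecahedron vertices $\frac1{\sqrt3}(\pm1,\pm1,\pm1)$ and all even permutations of $\frac1{\sqrt3}(\pm\phi,0,\pm\phi^{-1})$. *)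

theory Defs
  imports "HOL-Analysis.Analysis"
begin

section \<open>The normalized rotation-invariant measure on the sphere\<close>

text \<open>
  The distribution of \<open>x / |x|\<close> for \<open>x\<close> uniformly distributed in the unit ball. The lemmas below
  show that it has total mass 1 and is invariant under orthogonal transformations.
\<close>

definition sphere_measure :: "'a::euclidean_space measure" where
  "sphere_measure =
     restrict_space (distr (uniform_measure lborel (ball 0 1)) borel sgn) (sphere 0 1)"

lemma space_sphere_measure: "space sphere_measure = sphere 0 1"
  by (simp add: sphere_measure_def space_restrict_space)

lemma sets_sphere_measure: "sets sphere_measure = sets (restrict_space borel (sphere 0 1))"
  unfolding sphere_measure_def by (rule sets_restrict_space_cong) simp

lemma emeasure_sphere_measure:
  fixes A :: "'a::euclidean_space set"
  assumes "A \<in> sets borel" "A \<subseteq> sphere 0 1"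
  shows "emeasure sphere_measure A =
         emeasure lborel (ball 0 1 \<inter> sgn -` A) / emeasure lborel (ball 0 1 :: 'a set)"
proof -
  have sgn: "sgn \<in> measurable (uniform_measure lborel (ball 0 1 :: 'a set)) borel"
    by simp
  have "emeasure sphere_measure A = emeasure (distr (uniform_measure lborel (ball 0 1)) borel sgn) A"
    unfolding sphere_measure_def using assms by (intro emeasure_restrict_space) auto
  also have "\<dots> = emeasure (uniform_measure lborel (ball 0 1)) (sgn -` A)"
    using assms sgn by (subst emeasure_distr) auto
  also have "\<dots> = emeasure lborel (ball 0 1 \<inter> sgn -` A) / emeasure lborel (ball 0 1 :: 'a set)"
    using assms measurable_sets[OF sgn assms(1)] by (intro emeasure_uniform_measure) auto
  finally show ?thesis .
qed

lemma emeasure_sphere_measure_sphere: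
  "emeasure sphere_measure (sphere 0 1 :: 'a::euclidean_space set) = 1"
proof -
  let ?B = "ball 0 1 :: 'a set"
  have 1: "?B \<inter> sgn -` sphere 0 1 = ?B - {0}"
    by (auto simp: norm_sgn)
  have 2: "emeasure lborel (?B - {0}) = emeasure lborel ?B"
    by (rule emeasure_Diff_null_set) auto
  have "emeasure lborel ?B = ennreal (unit_ball_vol (real DIM('a)))"
    using emeasure_ball[of 1 "0 :: 'a"] by simp
  moreover have "unit_ball_vol (real DIM('a)) > 0"
    by (rule unit_ball_vol_pos) simp
  ultimately have "emeasure lborel ?B \<noteq> 0" "emeasure lborel ?B < top"
    by (metis ennreal_eq_0_iff not_le, metis ennreal_less_top)
  then have 3: "emeasure lborel ?B / emeasure lborel ?B = 1"
    by (rule ennreal_divide_self)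
  have "emeasure sphere_measure (sphere 0 1 :: 'a set) =
      emeasure lborel (?B \<inter> sgn -` sphere 0 1) / emeasure lborel ?B"
    by (rule emeasure_sphere_measure) auto
  then show ?thesis
    unfolding 1 2 3 .
qed

lemma emeasure_sphere_measure_orthogonal_image:
  fixes f :: "real^'n::{finite,wellorder} \<Rightarrow> real^'n::{finite,wellorder}"
  assumes f: "orthogonal_transformation f" and A: "A \<in> sets borel" "A \<subseteq> sphere 0 1"
  shows "emeasure sphere_measure (f ` A) = emeasure sphere_measure A"
proof -
  define C where "C = ball 0 1 \<inter> sgn -` A"
  have lin: "linear f" and nrm: "\<And>x. norm (f x) = norm x" and inj: "inj f" and surj: "surj f"
    using f by (auto simp: orthogonal_transformation_linear orthogonal_transformation_norm
        orthogonal_transformation_inj orthogonal_transformation_surj)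
  obtain g where g: "linear g" "\<And>x. g (f x) = x" "\<And>x. f (g x) = x"
    using linear_injective_isomorphism[OF lin inj] by auto
  have fim: "f ` S = g -` S" for S
    using g(2,3) by (metis (no_types, lifting) bij_image_Collect_eq bij_vimage_eq_inv_image ext
        inj_imp_bij_betw_inv inj surj bij_def inv_equality inv_inv_eq)
  have gm: "g \<in> borel_measurable borel"
    using g(1) by (intro borel_measurable_continuous_onI linear_continuous_on)
      (simp add: linear_conv_bounded_linear)
  have fA: "f ` A \<in> sets borel"
    unfolding fim using measurable_sets[OF gm A(1)] by simp
  have Cb: "C \<in> sets borel"
    unfolding C_def using measurable_sets[OF borel_measurable_sgn A(1)] by auto
  have fC: "f ` C \<in> sets borel"
    unfolding fim using measurable_sets[OF gm Cb] by simp
  have sgnf: "sgn (f x) = f (sgn x)" for x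
    by (simp add: sgn_div_norm nrm linear_scale[OF lin])
  have eq: "ball 0 1 \<inter> sgn -` (f ` A) = f ` C"
  proof (intro equalityI subsetI)
    fix y assume y: "y \<in> ball 0 1 \<inter> sgn -` (f ` A)"
    have "sgn (g y) \<in> A"
      using y sgnf[of "g y"] g(3)[of y] inj by (auto simp: inj_def)
    moreover have "norm (g y) < 1"
      using y nrm[of "g y"] g(3)[of y] by simp
    ultimately show "y \<in> f ` C"
      using g(3)[of y] by (auto simp: C_def intro!: image_eqI[of _ _ "g y"])
  qed (auto simp: C_def nrm sgnf)
  have Cl: "C \<in> lmeasurable"
    using Cb by (intro bounded_set_imp_lmeasurable) (auto simp: C_def bounded_Int)
  have "emeasure lborel (f ` C) = emeasure lebesgue (f ` C)"
    using fC by simp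
  also have "\<dots> = emeasure lebesgue C"
    using measure_orthogonal_image[OF f Cl] Cl measurable_orthogonal_image[OF f Cl]
    by (simp add: emeasure_eq_measure2)
  also have "\<dots> = emeasure lborel C"
    using Cb by simp
  finally have "emeasure lborel (f ` C) = emeasure lborel C" .
  moreover have "f ` A \<subseteq> sphere 0 1"
    using A(2) nrm by auto
  ultimately show ?thesis
    using A fA by (simp add: emeasure_sphere_measure eq flip: C_def)
qed


section \<open>Polynomials on the sphere\<close>

text \<open>
  Restriction to the sphere is expressed by leaving the values of the functions outside the sphere
  unconstrained.
\<close>

definition Pol :: "nat \<Rightarrow> (real^3 \<Rightarrow> real) set" where
  "Pol s = {p. \<exists>c. \<forall>x\<in>sphere 0 1.
     p x = (\<Sum>(i, j, k) \<in> {(i, j, k). i + j + k \<le> s}. c i j k * (x$1)^i * (x$2)^j * (x$3)^k)}"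


section \<open>Geodesic arcs and geodesic cycles\<close>

definition arc_length_integral :: "(real \<Rightarrow> 'a::real_normed_vector) \<Rightarrow> ('a \<Rightarrow> real) \<Rightarrow> real" where
  "arc_length_integral g f =
     integral {0..1} (\<lambda>t. f (g t) * norm (vector_derivative g (at t within {0..1})))"

text \<open>
  The shortest great-circle arc from \<open>x\<close> to \<open>y\<close>, for unit vectors \<open>x\<close>, \<open>y\<close> with \<open>y \<noteq> x\<close> and
  \<open>y \<noteq> -x\<close>, parametrized with constant speed. As shown below, it has length \<open>arccos (x \<bullet> y)\<close>, the spherical
  distance, and its image is the radial projection of the segment from \<open>x\<close> to \<open>y\<close>.
\<close>

definition geodesic :: "'a::real_inner \<Rightarrow> 'a \<Rightarrow> real \<Rightarrow> 'a" where
  "geodesic x y t = (let \<theta> = arccos (x \<bullet> y) in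
     (sin ((1 - t) * \<theta>) / sin \<theta>) *\<^sub>R x + (sin (t * \<theta>) / sin \<theta>) *\<^sub>R y)"

context
  fixes x y :: "'a::real_inner"
  assumes xy: "norm x = 1" "norm y = 1" "y \<noteq> x" "y \<noteq> - x"
begin

lemma abs_inner_less_1: "\<bar>x \<bullet> y\<bar> < 1"
proof -
  have "\<bar>x \<bullet> y\<bar> \<le> 1"
    using Cauchy_Schwarz_ineq2[of x y] xy by simp
  moreover have "x \<bullet> y \<noteq> 1"
  proof
    assume "x \<bullet> y = 1"
    moreover have "(norm (x - y))\<^sup>2 = (norm x)\<^sup>2 + (norm y)\<^sup>2 - 2 * (x \<bullet> y)"
      unfolding power2_norm_eq_inner by (simp add: inner_diff_left inner_diff_right inner_commute)
    ultimately have "norm (x - y) = 0"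
      using xy(1,2) by simp
    then show False using xy(3) by simp
  qed
  moreover have "x \<bullet> y \<noteq> - 1"
  proof
    assume "x \<bullet> y = - 1"
    moreover have "(norm (x + y))\<^sup>2 = (norm x)\<^sup>2 + (norm y)\<^sup>2 + 2 * (x \<bullet> y)"
      unfolding power2_norm_eq_inner by (simp add: inner_add_left inner_add_right inner_commute)
    ultimately have "norm (x + y) = 0"
      using xy(1,2) by simp
    then show False using xy(4) by (simp add: add_eq_0_iff)
  qed
  ultimately show ?thesis by linarith
qed

lemma arccos_inner_bounds: "0 < arccos (x \<bullet> y)" "arccos (x \<bullet> y) < pi"
  and cos_arccos_inner: "cos (arccos (x \<bullet> y)) = x \<bullet> y"
  and sin_arccos_inner_pos: "0 < sin (arccos (x \<bullet> y))"
proof -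
  show *: "0 < arccos (x \<bullet> y)" "arccos (x \<bullet> y) < pi"
    using abs_inner_less_1 arccos_lt_bounded[of "x \<bullet> y"] by auto
  show "cos (arccos (x \<bullet> y)) = x \<bullet> y"
    using abs_inner_less_1 by (intro cos_arccos) auto
  show "0 < sin (arccos (x \<bullet> y))"
    using * by (rule sin_gt_zero)
qed

lemma geodesic_0: "geodesic x y 0 = x" and geodesic_1: "geodesic x y 1 = y"
  using sin_arccos_inner_pos by (simp_all add: geodesic_def Let_def)

lemma norm_combination:
  assumes "a\<^sup>2 + b\<^sup>2 + 2 * a * b * (x \<bullet> y) = c\<^sup>2" "c \<ge> 0"
  shows "norm (a *\<^sub>R x + b *\<^sub>R y) = c"
proof -
  have "(norm (a *\<^sub>R x + b *\<^sub>R y))\<^sup>2 = a\<^sup>2 * (norm x)\<^sup>2 + b\<^sup>2 * (norm y)\<^sup>2 + 2 * a * b * (x \<bullet> y)"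
    unfolding power2_norm_eq_inner
    by (simp add: inner_add_left inner_add_right inner_commute algebra_simps power2_eq_square)
  also have "\<dots> = c\<^sup>2"
    using xy assms by simp
  finally show ?thesis
    using assms(2) by (simp add: power2_eq_iff_nonneg)
qed

lemma norm_geodesic: "norm (geodesic x y t) = 1"
proof -
  define \<theta> u where "\<theta> = arccos (x \<bullet> y)" and "u = t * \<theta>"
  have s: "sin \<theta> > 0" and c: "x \<bullet> y = cos \<theta>"
    using sin_arccos_inner_pos cos_arccos_inner by (simp_all add: \<theta>_def)
  have "(sin (\<theta> - u))\<^sup>2 + (sin u)\<^sup>2 + 2 * sin (\<theta> - u) * sin u * cos \<theta> = (sin \<theta>)\<^sup>2"
    unfolding sin_diff using sin_cos_squared_add[of u] sin_cos_squared_add[of \<theta>] by algebra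
  then have "(sin (\<theta> - u) / sin \<theta>)\<^sup>2 + (sin u / sin \<theta>)\<^sup>2 +
      2 * (sin (\<theta> - u) / sin \<theta>) * (sin u / sin \<theta>) * (x \<bullet> y) = 1\<^sup>2"
    using s unfolding c by (simp add: field_simps power2_eq_square)
  from norm_combination[OF this] show ?thesis
    by (simp add: geodesic_def Let_def u_def algebra_simps flip: \<theta>_def)
qed

lemma norm_vector_derivative_geodesic:
  assumes "t \<in> {0..1}"
  shows "norm (vector_derivative (geodesic x y) (at t within {0..1})) = arccos (x \<bullet> y)"
proof -
  define \<theta> u where "\<theta> = arccos (x \<bullet> y)" and "u = t * \<theta>"
  have s: "sin \<theta> > 0" and c: "x \<bullet> y = cos \<theta>" and \<theta>: "\<theta> > 0"
    using sin_arccos_inner_pos cos_arccos_inner arccos_inner_bounds by (simp_all add: \<theta>_def)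
  have "(geodesic x y has_vector_derivative
      (- (\<theta> * cos (\<theta> - u)) / sin \<theta>) *\<^sub>R x + (\<theta> * cos u / sin \<theta>) *\<^sub>R y) (at t within {0..1})"
    unfolding geodesic_def Let_def \<theta>_def[symmetric] u_def using s
    by (auto intro!: derivative_eq_intros simp: has_real_derivative_iff_has_vector_derivative[symmetric]
        algebra_simps)
  then have d: "vector_derivative (geodesic x y) (at t within {0..1}) =
      (- (\<theta> * cos (\<theta> - u)) / sin \<theta>) *\<^sub>R x + (\<theta> * cos u / sin \<theta>) *\<^sub>R y"
    using assms by (intro vector_derivative_within_cbox[of 0 1, unfolded cbox_interval]) auto
  have "(cos (\<theta> - u))\<^sup>2 + (cos u)\<^sup>2 - 2 * cos (\<theta> - u) * cos u * cos \<theta> = (sin \<theta>)\<^sup>2"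
    unfolding cos_diff using sin_cos_squared_add[of u] sin_cos_squared_add[of \<theta>] by algebra
  then have "\<theta>\<^sup>2 * ((cos (\<theta> - u))\<^sup>2 + (cos u)\<^sup>2 - 2 * cos (\<theta> - u) * cos u * cos \<theta>) = \<theta>\<^sup>2 * (sin \<theta>)\<^sup>2"
    by simp
  then have "(- (\<theta> * cos (\<theta> - u)) / sin \<theta>)\<^sup>2 + (\<theta> * cos u / sin \<theta>)\<^sup>2 +
      2 * (- (\<theta> * cos (\<theta> - u)) / sin \<theta>) * (\<theta> * cos u / sin \<theta>) * (x \<bullet> y) = \<theta>\<^sup>2"
    using s unfolding c by (simp add: field_simps power2_eq_square)
  from norm_combination[OF this] show ?thesis
    using \<theta> by (simp add: d flip: \<theta>_def)
qed

lemma arc_length_geodesic: "arc_length_integral (geodesic x y) (\<lambda>_. 1) = arccos (x \<bullet> y)"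
proof -
  have "arc_length_integral (geodesic x y) (\<lambda>_. 1) = integral {0..1::real} (\<lambda>_. arccos (x \<bullet> y))"
    unfolding arc_length_integral_def
    by (rule integral_cong) (simp add: norm_vector_derivative_geodesic)
  then show ?thesis by simp
qed

lemma path_image_geodesic: "geodesic x y ` {0..1} = sgn ` closed_segment x y"
proof -
  define \<theta> where "\<theta> = arccos (x \<bullet> y)"
  have \<theta>: "0 < \<theta>" "\<theta> < pi" and s: "sin \<theta> > 0"
    using sin_arccos_inner_pos arccos_inner_bounds by (simp_all add: \<theta>_def)
  define r where "r t = sin ((1 - t) * \<theta>) + sin (t * \<theta>)" for t
  define q where "q t = sin (t * \<theta>) / r t" for t
  have pos: "r t > 0" "0 \<le> q t" "q t \<le> 1" if "t \<in> {0..1}" for t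
  proof -
    have t: "t * \<theta> \<le> \<theta>" "(1 - t) * \<theta> \<le> \<theta>" "0 \<le> t * \<theta>" "0 \<le> (1 - t) * \<theta>"
      using that \<theta> by (auto simp: mult_left_le_one_le)
    with \<theta>(2) have t': "t * \<theta> < pi" "(1 - t) * \<theta> < pi" by linarith+
    have nn: "0 \<le> sin (t * \<theta>)" "0 \<le> sin ((1 - t) * \<theta>)"
      using t t' by (auto intro!: sin_ge_zero)
    have "0 < sin (t * \<theta>)" if "t > 0"
      using that t' \<theta> by (intro sin_gt_zero mult_pos_pos)
    moreover have "0 < sin ((1 - t) * \<theta>)" if "t = 0"
      using that s by simp
    ultimately show r: "r t > 0"
      using nn that unfolding r_def by (cases "t = 0") (auto intro: add_pos_nonneg add_nonneg_pos)
    show "0 \<le> q t" "q t \<le> 1"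
      using r nn by (auto simp: q_def) (simp add: r_def)
  qed
  have eq: "geodesic x y t = sgn ((1 - q t) *\<^sub>R x + q t *\<^sub>R y)" if "t \<in> {0..1}" for t
  proof -
    have "1 - q t = sin ((1 - t) * \<theta>) / r t"
      using pos[OF that] by (simp add: q_def r_def field_simps)
    then have "(1 - q t) *\<^sub>R x + q t *\<^sub>R y = (sin \<theta> / r t) *\<^sub>R geodesic x y t"
      using s by (simp add: geodesic_def Let_def q_def scaleR_add_right flip: \<theta>_def)
    then have "sgn ((1 - q t) *\<^sub>R x + q t *\<^sub>R y) = sgn (geodesic x y t)"
      using s pos[OF that] by (simp add: sgn_scaleR)
    also have "\<dots> = geodesic x y t"
      by (simp add: sgn_div_norm norm_geodesic)
    finally show ?thesis ..
  qed
  have "q ` {0..1} = {0..1}"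
  proof
    have "continuous_on {0..1} q"
    proof -
      have "continuous_on {0..1} r"
        unfolding r_def by (intro continuous_intros)
      then show ?thesis
        unfolding q_def using pos(1) by (intro continuous_intros) (auto simp: less_imp_neq[symmetric])
    qed
    moreover have "q 0 = 0" "q 1 = 1"
      using s by (simp_all add: q_def r_def)
    ultimately show "{0..1} \<subseteq> q ` {0..1}"
      using IVT'[of q 0 _ 1] by fastforce
  qed (use pos in auto)
  then have "sgn ` closed_segment x y = (\<lambda>t. sgn ((1 - q t) *\<^sub>R x + q t *\<^sub>R y)) ` {0..1}"
    unfolding closed_segment_image_interval by (metis (no_types, lifting) image_image image_cong)
  also have "\<dots> = geodesic x y ` {0..1}"
    using eq by (intro image_cong) auto
  finally show ?thesis ..
qed

end

text \<open>
  A geodesic cycle is represented by the list of the end points of its consecutive arcs, where the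
  last point coincides with the first one.
\<close>

definition steps :: "'a list \<Rightarrow> ('a \<times> 'a) list" where
  "steps w = zip w (tl w)"

definition geodesic_cycle :: "'a::real_inner list \<Rightarrow> bool" where
  "geodesic_cycle \<gamma> \<longleftrightarrow> 2 \<le> length \<gamma> \<and> hd \<gamma> = last \<gamma> \<and> set \<gamma> \<subseteq> sphere 0 1 \<and>
     (\<forall>(x, y) \<in> set (steps \<gamma>). y \<noteq> x \<and> y \<noteq> - x)"

definition cycle_integral :: "'a::real_inner list \<Rightarrow> ('a \<Rightarrow> real) \<Rightarrow> real" where
  "cycle_integral \<gamma> f = (\<Sum>(x, y) \<leftarrow> steps \<gamma>. arc_length_integral (geodesic x y) f)"

definition cycle_length :: "'a::real_inner list \<Rightarrow> real" where
  "cycle_length \<gamma> = cycle_integral \<gamma> (\<lambda>_. 1)"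


section \<open>Hybrid designs\<close>

definition hybrid_design :: "nat \<Rightarrow> real \<Rightarrow> (real^3) list \<Rightarrow> (real^3) set \<Rightarrow> bool" where
  "hybrid_design s \<beta> \<gamma> X \<longleftrightarrow>
     0 \<le> \<beta> \<and> \<beta> \<le> 1 \<and> geodesic_cycle \<gamma> \<and> finite X \<and> X \<noteq> {} \<and> X \<subseteq> sphere 0 1 \<and>
     (\<forall>p\<in>Pol s. \<beta> / card X * (\<Sum>x\<in>X. p x) + (1 - \<beta>) / cycle_length \<gamma> * cycle_integral \<gamma> p
        = (LINT x|sphere_measure. p x))"


section \<open>Cycles induced by the edges of a polytope\<close>

text \<open>A graph is given by its set of edges, which are two-element sets of points.\<close>

definition euler_cycle :: "'a set set \<Rightarrow> 'a list \<Rightarrow> bool" where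
  "euler_cycle E w \<longleftrightarrow> w \<noteq> [] \<and> hd w = last w \<and>
     distinct (map (\<lambda>(x, y). {x, y}) (steps w)) \<and> set (map (\<lambda>(x, y). {x, y}) (steps w)) = E"

text \<open>\<open>sgn\<close> is the radial projection onto the sphere.\<close>

definition induced_cycle :: "'a::real_inner set set \<Rightarrow> 'a list \<Rightarrow> bool" where
  "induced_cycle E \<gamma> \<longleftrightarrow> (\<exists>w. euler_cycle E w \<and> \<gamma> = map sgn w)"

definition edges_inner :: "'a::real_inner set \<Rightarrow> real \<Rightarrow> 'a set set" where
  "edges_inner V c = {{x, y} | x y. x \<in> V \<and> y \<in> V \<and> x \<bullet> y = c}"


section \<open>The polytopes\<close>

definition golden :: real where
  "golden = (1 + sqrt 5) / 2"

definition sign_changes :: "real^'n \<Rightarrow> (real^'n) set" where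
  "sign_changes v = {w. \<forall>i. w $ i = v $ i \<or> w $ i = - v $ i}"

definition coord_perms :: "'a^'n \<Rightarrow> ('a^'n) set" where
  "coord_perms v = {(\<chi> i. v $ \<pi> i) | \<pi>. \<pi> permutes UNIV}"

definition even_coord_perms :: "'a^'n \<Rightarrow> ('a^'n) set" where
  "even_coord_perms v = {(\<chi> i. v $ \<pi> i) | \<pi>. \<pi> permutes UNIV \<and> evenperm \<pi>}"

lemma permutes_3:
  "{p. p permutes (UNIV :: 3 set)} =
     (\<lambda>(b, c). Transposition.transpose 1 b \<circ> Transposition.transpose 2 c) ` ({1, 2, 3} \<times> {2, 3})"
proof -
  have *: "{p. p permutes {3 :: 3}} = {id}"
    by (simp add: permutes_sing)
  have **: "{(b, p). b \<in> A \<and> p \<in> B} = A \<times> B" for A :: "'b set" and B :: "'c set"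
    by auto
  show ?thesis
    unfolding UNIV_3 permutes_insert[of 1 "{2, 3}"] permutes_insert[of 2 "{3}"] * **
    by (simp add: insert_Times_insert)
qed

lemma vec_lambda_3: "(\<chi> i. f i) = (vector [f 1, f 2, f 3] :: 'a::zero^3)"
  by (simp add: vec_eq_iff forall_3)

lemma coord_perms_3:
  "coord_perms (vector [a, b, c] :: 'a::zero^3) =
     {vector [a, b, c], vector [b, c, a], vector [c, a, b],
      vector [a, c, b], vector [c, b, a], vector [b, a, c]}"
proof -
  have "coord_perms (vector [a, b, c]) =
      (\<lambda>\<pi>. \<chi> i. (vector [a, b, c] :: 'a^3) $ \<pi> i) ` {\<pi>. \<pi> permutes (UNIV :: 3 set)}"
    by (auto simp: coord_perms_def)
  also have "\<dots> = {vector [a, b, c], vector [b, c, a], vector [c, a, b],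
      vector [a, c, b], vector [c, b, a], vector [b, a, c]}"
    unfolding permutes_3
    by (simp add: vec_lambda_3 Transposition.transpose_def insert_commute insert_Times_insert)
  finally show ?thesis .
qed

lemma even_coord_perms_3:
  "even_coord_perms (vector [a, b, c] :: 'a::zero^3) =
     {vector [a, b, c], vector [b, c, a], vector [c, a, b]}"
proof -
  have "even_coord_perms (vector [a, b, c]) =
      (\<lambda>\<pi>. \<chi> i. (vector [a, b, c] :: 'a^3) $ \<pi> i) `
        {\<pi> \<in> {\<pi>. \<pi> permutes (UNIV :: 3 set)}. evenperm \<pi>}"
    by (auto simp: even_coord_perms_def)
  also have "{\<pi> \<in> {\<pi>. \<pi> permutes (UNIV :: 3 set)}. evenperm \<pi>} =
      {id, Transposition.transpose 1 2 \<circ> Transposition.transpose 2 3, Transposition.transpose 1 3 \<circ> Transposition.transpose 2 3}"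
    unfolding permutes_3
    by (auto simp: evenperm_comp evenperm_swap permutation_swap_id)
  also have "(\<lambda>\<pi>. \<chi> i. (vector [a, b, c] :: 'a^3) $ \<pi> i) ` \<dots> =
      {vector [a, b, c], vector [b, c, a], vector [c, a, b]}"
    by (simp add: vec_lambda_3 Transposition.transpose_def insert_commute)
  finally show ?thesis .
qed

definition octahedron_vertices :: "(real^3) set" where
  "octahedron_vertices = range (\<lambda>i. axis i 1) \<union> range (\<lambda>i. - axis i 1)"

definition cube_vertices :: "(real^3) set" where
  "cube_vertices = (\<lambda>v. (1 / sqrt 3) *\<^sub>R v) ` sign_changes (vector [1, 1, 1])"

definition cuboctahedron_vertices :: "(real^3) set" where
  "cuboctahedron_vertices =
     (\<lambda>v. (1 / sqrt 2) *\<^sub>R v) ` (\<Union>u\<in>sign_changes (vector [1, 1, 0]). coord_perms u)"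

definition rhombic_dodecahedron_vertices :: "(real^3) set" where
  "rhombic_dodecahedron_vertices = cube_vertices \<union> octahedron_vertices"

definition icosidodecahedron_vertices :: "(real^3) set" where
  "icosidodecahedron_vertices = octahedron_vertices \<union>
     (\<lambda>v. (1 / 2) *\<^sub>R v) ` (\<Union>u\<in>sign_changes (vector [golden, 1 / golden, 1]). even_coord_perms u)"

definition icosahedron_vertices :: "(real^3) set" where
  "icosahedron_vertices =
     (\<lambda>v. (1 / sqrt (1 + golden\<^sup>2)) *\<^sub>R v) `
       (\<Union>u\<in>sign_changes (vector [golden, 1, 0]). even_coord_perms u)"

definition dodecahedron_vertices :: "(real^3) set" where
  "dodecahedron_vertices = cube_vertices \<union>
     (\<lambda>v. (1 / sqrt 3) *\<^sub>R v) `
       (\<Union>u\<in>sign_changes (vector [golden, 0, 1 / golden]). even_coord_perms u)"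

definition rhombic_triacontahedron_vertices :: "(real^3) set" where
  "rhombic_triacontahedron_vertices = icosahedron_vertices \<union> dodecahedron_vertices"

definition cuboctahedron_edges :: "(real^3) set set" where
  "cuboctahedron_edges = edges_inner cuboctahedron_vertices (1 / 2)"

definition icosidodecahedron_edges :: "(real^3) set set" where
  "icosidodecahedron_edges = edges_inner icosidodecahedron_vertices (golden / 2)"

end

theory Submission
  imports Defs
begin

text \<open>
  Both sides of the defining equation of a hybrid design are linear functionals on polynomials. The
  mean over the sphere is rotation invariant, so it maps the power \<open>(u \<bullet> x)\<^sup>n\<close> of a linear form to a
  constant multiple of \<open>\<bar>u\<bar>\<^sup>n\<close>. Powers of linear forms span the homogeneous polynomials of degree \<open>n\<close>,
  and on the sphere a homogeneous polynomial of degree \<open>n - 2k\<close> becomes one of degree \<open>n\<close> after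
  multiplication by \<open>\<bar>x\<bar>\<^sup>2\<^sup>k\<close>. Hence a normalized functional that also maps \<open>(u \<bullet> x)\<^sup>n\<close> to
  \<open>c \<bar>u\<bar>\<^sup>n\<close> with \<open>c \<noteq> 0\<close>, \<open>n\<close> even, and kills the powers of degree \<open>n + 1\<close>, agrees with the mean on all polynomials of
  degree at most \<open>n + 1\<close> (\<open>rotation_invariant_eq\<close>); evaluation at the constant 1 fixes the
  scale, so that no integral over the sphere has to be computed. This leaves one identity between polynomials
  in \<open>u\<close>, of degree 4 for the cuboctahedron and of degree 8 for the icosidodecahedron.

  For the contribution of the cycle, every edge arc continues on its great circle with another edge arc, since
  the half-turn about a vertex preserves the polytope. The edges therefore decompose into regular polygons on
  great circles (hexagons and decagons), and the mean over the cycle is the average of the means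
  over these circles (\<open>edge_mean\<close>), whatever Euler cycle is chosen. The mean of \<open>(u \<bullet> x)\<^sup>2\<^sup>m\<close> over the
  great circle with unit normal \<open>n\<close> is \<open>(2m choose m) / 4\<^sup>m\<close> times the \<open>m\<close>-th power of
  \<open>\<bar>u\<bar>\<^sup>2 - (u \<bullet> n)\<^sup>2\<close> (\<open>great_circle_mean_power_cross\<close>).

  After rescaling, all vertices and normals have coordinates in \<open>\<int>[\<phi>]\<close>, where \<open>\<phi>\<close> is the golden ratio. The
  combinatorial facts about the edge graphs are decided by integer arithmetic in this ring, and the
  remaining identities follow from \<open>\<phi>\<^sup>2 = \<phi> + 1\<close>.
\<close>

section \<open>Linear functionals on the sphere and powers of linear forms\<close>

text \<open>
  Linearity is required on continuous functions only, because integrals are not additive on arbitrary ones.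
  The last assumption gives access to the elements of \<open>Pol s\<close>, whose values off the sphere are arbitrary
  and which therefore need not be continuous.
\<close>
locale sphere_functional =
  fixes L :: "(real^3 \<Rightarrow> real) \<Rightarrow> real"
  assumes add: "continuous_on UNIV f \<Longrightarrow> continuous_on UNIV g \<Longrightarrow> L (\<lambda>x. f x + g x) = L f + L g"
    and scale: "continuous_on UNIV f \<Longrightarrow> L (\<lambda>x. c * f x) = c * L f"
    and cong: "(\<And>x. x \<in> sphere 0 1 \<Longrightarrow> f x = g x) \<Longrightarrow> L f = L g"
begin

lemma zero: "L (\<lambda>_. 0) = 0"
  using scale[of "\<lambda>_. 0" 0] by simp

lemma sum:
  assumes "finite A" "\<And>a. a \<in> A \<Longrightarrow> continuous_on UNIV (f a)"
  shows "L (\<lambda>x. \<Sum>a\<in>A. f a x) = (\<Sum>a\<in>A. L (f a))"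
  using assms
  by (induction A rule: finite_induct) (auto simp: zero add continuous_on_sum)

end

lemma sphere_functional_lincomb:
  assumes "sphere_functional L" "sphere_functional M"
  shows "sphere_functional (\<lambda>f. a * L f + b * M f)"
proof -
  interpret L: sphere_functional L by fact
  interpret M: sphere_functional M by fact
  show ?thesis
  proof
    fix f g :: "real^3 \<Rightarrow> real"
    assume "\<And>x. x \<in> sphere 0 1 \<Longrightarrow> f x = g x"
    then have "L f = L g" "M f = M g"
      by (auto intro: L.cong M.cong)
    then show "a * L f + b * M f = a * L g + b * M g"
      by simp
  qed (simp_all add: L.add M.add L.scale M.scale algebra_simps)
qed

definition monomial :: "nat \<Rightarrow> nat \<Rightarrow> nat \<Rightarrow> real^3 \<Rightarrow> real" where
  "monomial i j k x = (x$1)^i * (x$2)^j * (x$3)^k"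

lemma continuous_monomial [continuous_intros]: "continuous_on S (monomial i j k)"
  unfolding monomial_def by (intro continuous_intros)

text \<open>
  Multiplication by \<open>x\<^sub>1\<^sup>2 + x\<^sub>2\<^sup>2 + x\<^sub>3\<^sup>2 = 1\<close> raises the degree by 2.
\<close>
lemma monomial_on_sphere:
  assumes "x \<in> sphere 0 1"
  shows "monomial i j k x = monomial (i+2) j k x + monomial i (j+2) k x + monomial i j (k+2) x"
proof -
  have "(x$1)^2 + (x$2)^2 + (x$3)^2 = 1"
    using assms by (simp add: norm_eq_1 inner_vec_def sum_3 power2_eq_square)
  moreover have "monomial (i+2) j k x + monomial i (j+2) k x + monomial i j (k+2) x =
      monomial i j k x * ((x$1)^2 + (x$2)^2 + (x$3)^2)"
    by (simp add: monomial_def power_add power2_eq_square algebra_simps)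
  ultimately show ?thesis
    by simp
qed

lemma (in sphere_functional) monomial_vanish_lower:
  assumes "\<And>i j k. i + j + k = n + 2 * m \<Longrightarrow> L (monomial i j k) = 0" "i + j + k = n"
  shows "L (monomial i j k) = 0"
  using assms
proof (induction m arbitrary: n i j k)
  case (Suc m)
  have up: "L (monomial i j k) = 0" if "i + j + k = n + 2" for i j k
    by (rule Suc.IH[of "n + 2"]) (use Suc.prems(1) that in auto)
  have "L (monomial i j k) =
      L (\<lambda>x. (monomial (i+2) j k x + monomial i (j+2) k x) + monomial i j (k+2) x)"
    by (rule cong) (rule monomial_on_sphere)
  also have "\<dots> = L (monomial (i+2) j k) + L (monomial i (j+2) k) + L (monomial i j (k+2))"
    by (simp add: add continuous_intros)
  also have "\<dots> = 0"
    using Suc.prems(2) by (simp add: up)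
  finally show ?case .
qed simp

lemma inner_3: "u \<bullet> x = u$1 * x$1 + u$2 * x$2 + u$3 * x$3" for u x :: "real^3"
  by (simp add: inner_vec_def sum_3)

lemma power_linear_form_expansion:
  fixes x :: "real^3" and t r :: real
  shows "(vector [1, t, r] \<bullet> x)^n =
    (\<Sum>k\<le>n. (\<Sum>j\<le>n-k. (real (n choose k) * real ((n-k) choose j) * r^k * t^j) * monomial (n-k-j) j k x))"
proof -
  have "(vector [1, t, r] \<bullet> x)^n = (r * x$3 + (t * x$2 + x$1))^n"
    by (simp add: inner_3 vector_3 algebra_simps)
  also have "\<dots> = (\<Sum>k\<le>n. (n choose k) * (r * x$3)^k *
      (\<Sum>j\<le>n-k. ((n-k) choose j) * (t * x$2)^j * (x$1)^(n-k-j)))"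
    by (simp add: binomial_ring)
  also have "\<dots> = (\<Sum>k\<le>n. (\<Sum>j\<le>n-k. (real (n choose k) * real ((n-k) choose j) * r^k * t^j) * monomial (n-k-j) j k x))"
    by (simp add: sum_distrib_left monomial_def power_mult_distrib mult_ac)
  finally show ?thesis .
qed

text \<open>
  Polarization: for \<open>u = (1, t, r)\<close> the value of \<open>L\<close> at \<open>(u \<bullet> x)\<^sup>n\<close> is a polynomial in \<open>t\<close> and \<open>r\<close>
  whose coefficients are nonzero multiples of the values of \<open>L\<close> at the monomials of degree \<open>n\<close>.
\<close>
lemma (in sphere_functional) monomial_vanish_if_powers_vanish:
  assumes pow: "\<And>u. L (\<lambda>x. (u \<bullet> x)^n) = 0" and deg: "i + j + k = n"
  shows "L (monomial i j k) = 0"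
proof -
  have expand: "(\<Sum>k\<le>n. (\<Sum>j\<le>n-k. real (n choose k) * real ((n-k) choose j) * L (monomial (n-k-j) j k) * t^j) * r^k) = 0"
    for t r
  proof -
    have "0 = L (\<lambda>x. \<Sum>k\<le>n. (\<Sum>j\<le>n-k. (real (n choose k) * real ((n-k) choose j) * r^k * t^j) * monomial (n-k-j) j k x))"
      using pow[of "vector [1, t, r]"] by (simp only: power_linear_form_expansion)
    also have "\<dots> = (\<Sum>k\<le>n. (\<Sum>j\<le>n-k. (real (n choose k) * real ((n-k) choose j) * r^k * t^j) * L (monomial (n-k-j) j k)))"
      by (simp add: sum scale continuous_intros)
    finally show ?thesis
      by (simp add: sum_distrib_left sum_distrib_right mult_ac)
  qed
  have "(\<Sum>j\<le>n-k. real (n choose k) * real ((n-k) choose j) * L (monomial (n-k-j) j k) * t^j) = 0" for t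
  proof -
    have "\<forall>r. (\<Sum>k\<le>n. (\<Sum>j\<le>n-k. real (n choose k) * real ((n-k) choose j) * L (monomial (n-k-j) j k) * t^j) * r^k) = 0"
      using expand by blast
    then show ?thesis
      unfolding polyfun_eq_0 using deg by auto
  qed
  then have "\<forall>t. (\<Sum>j\<le>n-k. (real (n choose k) * real ((n-k) choose j) * L (monomial (n-k-j) j k)) * t^j) = 0"
    by simp
  then have "real (n choose k) * real ((n-k) choose j) * L (monomial (n-k-j) j k) = 0"
    unfolding polyfun_eq_0 using deg by auto
  moreover have "n - k - j = i" "k \<le> n" "j \<le> n - k"
    using deg by auto
  ultimately show ?thesis
    by simp
qed

lemma (in sphere_functional) Pol_eq:
  assumes "sphere_functional M" "p \<in> Pol s"
    and mono: "\<And>i j k. i + j + k \<le> s \<Longrightarrow> L (monomial i j k) = M (monomial i j k)"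
  shows "L p = M p"
proof -
  interpret M: sphere_functional M by fact
  let ?I = "{(i, j, k). i + j + k \<le> s}"
  obtain c where c: "\<And>x. x \<in> sphere 0 1 \<Longrightarrow> p x = (\<Sum>(i, j, k)\<in>?I. c i j k * (x$1)^i * (x$2)^j * (x$3)^k)"
    using assms(2) unfolding Pol_def by auto
  define q where "q a x = (case a of (i, j, k) \<Rightarrow> c i j k * monomial i j k x)" for a x
  have fin: "finite ?I"
    by (rule finite_subset[of _ "{..s} \<times> {..s} \<times> {..s}"]) auto
  have p: "p x = (\<Sum>a\<in>?I. q a x)" if "x \<in> sphere 0 1" for x
    unfolding c[OF that] by (intro sum.cong) (auto simp: monomial_def q_def mult_ac)
  have cont: "continuous_on UNIV (q a)" for a
    unfolding q_def by (cases a) (simp add: continuous_intros)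
  have "L p = (\<Sum>a\<in>?I. L (q a))" "M p = (\<Sum>a\<in>?I. M (q a))"
    using cong[OF p] M.cong[OF p] sum[OF fin cont] M.sum[OF fin cont] by simp_all
  moreover have "L (q a) = M (q a)" if "a \<in> ?I" for a
    unfolding q_def using that mono
    by (auto simp: scale M.scale continuous_intros)
  ultimately show ?thesis
    using sum.cong[OF refl, of ?I "\<lambda>a. L (q a)" "\<lambda>a. M (q a)"] by presburger
qed

text \<open>
  If \<open>M\<close> maps \<open>(u \<bullet> x)\<^sup>n\<close> to \<open>m \<bar>u\<bar>\<^sup>n\<close>, then \<open>m L - c M\<close> kills all powers of degree \<open>n\<close> and hence, by
  polarization, all monomials of degrees \<open>n, n - 2, \<dots>, 0\<close>. Degree 0 gives \<open>m = c\<close>, so \<open>c (L - M)\<close>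
  vanishes on these monomials. The constant \<open>m\<close> need not be known beforehand. In odd degrees both
  functionals kill all powers.
\<close>
lemma (in sphere_functional) rotation_invariant_eq:
  assumes M: "sphere_functional M"
    and norm1: "L (\<lambda>_. 1) = 1" "M (\<lambda>_. 1) = 1"
    and inv: "\<And>n. \<exists>m. \<forall>u. M (\<lambda>x. (u \<bullet> x)^n) = m * norm u ^ n"
    and n: "even n" "c \<noteq> 0" "\<And>u. L (\<lambda>x. (u \<bullet> x)^n) = c * norm u ^ n"
    and odd: "\<And>u. L (\<lambda>x. (u \<bullet> x)^(n+1)) = 0"
    and p: "p \<in> Pol (n+1)"
  shows "L p = M p"
proof (rule Pol_eq[OF M p])
  interpret M: sphere_functional M by fact
  have L: "sphere_functional L" by unfold_locales
  fix i j k assume ijk: "i + j + k \<le> n + 1"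
  show "L (monomial i j k) = M (monomial i j k)"
  proof (cases "even (i + j + k)")
    case True
    then obtain l where l: "n = i + j + k + 2 * l"
      using ijk n(1) by (metis Suc_eq_plus1 dvd_diff_nat even_Suc le_SucE le_add_diff_inverse dvdE)
    obtain m where m: "\<And>u. M (\<lambda>x. (u \<bullet> x)^n) = m * norm u ^ n"
      using inv by blast
    interpret D: sphere_functional "\<lambda>f. m * L f + (- c) * M f"
      by (rule sphere_functional_lincomb[OF L M])
    have low: "m * L (monomial i j k) + (- c) * M (monomial i j k) = 0"
      if "i + j + k + 2 * l = n" for i j k l
      by (rule D.monomial_vanish_lower[OF _ refl, of _ _ _ l])
        (rule D.monomial_vanish_if_powers_vanish[of n], use that m n(3) in auto)
    obtain h where h: "n = 2 * h" using n(1) by blast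
    have "monomial 0 0 0 = (\<lambda>_. 1)"
      by (simp add: monomial_def fun_eq_iff)
    then have "m = c"
      using low[of 0 0 0 h] h norm1 by simp
    then show ?thesis
      using low[of i j k l] l n(2) by simp
  next
    case False
    then obtain l where l: "n + 1 = i + j + k + 2 * l"
      using ijk n(1) by (metis Suc_eq_plus1 dvd_diff_nat even_Suc le_add_diff_inverse dvdE odd_even_add even_diff_nat)
    obtain m where m: "\<And>u. M (\<lambda>x. (u \<bullet> x)^(n+1)) = m * norm u ^ (n+1)"
      using inv by blast
    \<comment> \<open>The reflection of \<open>e\<close> to \<open>- e\<close> preserves the norm and changes the sign of an odd power.\<close>
    define e where "e = (axis 1 1 :: real^3)"
    have "M (\<lambda>x. (- e \<bullet> x)^(n+1)) = M (\<lambda>x. (-1) * (e \<bullet> x)^(n+1))"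
      using n(1) by simp
    also have "\<dots> = (-1) * M (\<lambda>x. (e \<bullet> x)^(n+1))"
      by (rule M.scale) (intro continuous_intros)
    finally have "m = 0"
      unfolding m by (simp add: e_def)
    interpret D: sphere_functional "\<lambda>f. 1 * L f + (- 1) * M f"
      by (rule sphere_functional_lincomb[OF L M])
    have "1 * L (monomial i j k) + (- 1) * M (monomial i j k) = 0"
      by (rule D.monomial_vanish_lower[OF _ refl, of _ _ _ l])
        (rule D.monomial_vanish_if_powers_vanish[of "n+1"], use l m odd \<open>m = 0\<close> in auto)
    then show ?thesis by simp
  qed
qed

section \<open>The mean over the sphere\<close>

lemma finite_measure_sphere_measure: "finite_measure (sphere_measure :: 'a::euclidean_space measure)"
  by (rule finite_measureI) (simp add: space_sphere_measure emeasure_sphere_measure_sphere)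

lemma integrable_sphere_measure:
  assumes "continuous_on UNIV (f :: 'a::euclidean_space \<Rightarrow> real)"
  shows "integrable sphere_measure f"
proof -
  interpret finite_measure "sphere_measure :: 'a measure" by (rule finite_measure_sphere_measure)
  have "f \<in> borel_measurable borel"
    using assms by (rule borel_measurable_continuous_onI)
  then have "f \<in> borel_measurable sphere_measure"
    using measurable_cong_sets[OF sets_sphere_measure refl] measurable_restrict_space1 by blast
  moreover have "compact (f ` sphere 0 1)"
    by (intro compact_continuous_image continuous_on_subset[OF assms]) auto
  then obtain B where "\<And>x. x \<in> sphere 0 1 \<Longrightarrow> norm (f x) \<le> B"
    using compact_imp_bounded[of "f ` sphere 0 1"] by (force simp: bounded_iff)
  ultimately show ?thesis
    by (intro integrable_const_bound[of _ B] AE_I2) (auto simp: space_sphere_measure)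
qed

lemma sphere_functional_sphere_measure: "sphere_functional (\<lambda>f. LINT x|sphere_measure. f x)"
  by unfold_locales
    (auto simp: integrable_sphere_measure space_sphere_measure intro!: Bochner_Integration.integral_cong)

lemma measurable_orthogonal_transformation:
  fixes T :: "'a::euclidean_space \<Rightarrow> 'a"
  assumes T: "orthogonal_transformation T"
  shows "T \<in> measurable sphere_measure sphere_measure"
proof -
  have lin: "linear T" and nrm: "\<And>x. norm (T x) = norm x"
    using T by (auto simp: orthogonal_transformation_linear orthogonal_transformation_norm)
  have Tb: "T \<in> borel_measurable borel"
    using lin by (intro borel_measurable_continuous_onI linear_continuous_on)
      (simp add: linear_conv_bounded_linear)
  have "T \<in> measurable (restrict_space borel (sphere 0 1)) (restrict_space borel (sphere 0 1))"
    by (intro measurable_restrict_space2 measurable_restrict_space1 Tb)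
      (auto simp: space_restrict_space nrm)
  then show ?thesis
    using measurable_cong_sets[OF sets_sphere_measure sets_sphere_measure] by blast
qed

lemma sphere_measure_orthogonal_transformation:
  fixes T :: "real^'n::{finite,wellorder} \<Rightarrow> real^'n::{finite,wellorder}"
  assumes T: "orthogonal_transformation T"
  shows "distr sphere_measure sphere_measure T = sphere_measure"
proof -
  have nrm: "\<And>x. norm (inv T x) = norm x"
    using orthogonal_transformation_inv[OF T] by (auto simp: orthogonal_transformation_norm)
  have bij: "bij T" by (rule orthogonal_transformation_bij[OF T])
  have invT: "orthogonal_transformation (inv T)"
    by (rule orthogonal_transformation_inv[OF T])
  have meas: "T \<in> measurable sphere_measure sphere_measure"
    by (rule measurable_orthogonal_transformation[OF T])
  show ?thesis
  proof (rule measure_eqI)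
    fix A assume A: "A \<in> sets (distr sphere_measure sphere_measure T)"
    then have A': "A \<in> sets sphere_measure" by simp
    then have A'': "A \<in> sets borel" "A \<subseteq> sphere 0 1"
      unfolding sets_sphere_measure by (auto simp: sets_restrict_space_iff)
    have "T -` A \<inter> space sphere_measure = inv T ` A"
      using A''(2) nrm bij_vimage_eq_inv_image[OF bij, of A] by (auto simp: space_sphere_measure)
    then have "emeasure (distr sphere_measure sphere_measure T) A = emeasure sphere_measure (inv T ` A)"
      using meas A' by (simp add: emeasure_distr)
    also have "\<dots> = emeasure sphere_measure A"
      by (rule emeasure_sphere_measure_orthogonal_image[OF invT A''])
    finally show "emeasure (distr sphere_measure sphere_measure T) A = emeasure sphere_measure A" .
  qed simp
qed

text \<open>
  An orthogonal transformation takes the multiple \<open>\<bar>u\<bar> e\<close> of a fixed unit vector \<open>e\<close> to \<open>u\<close>.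
\<close>
lemma sphere_mean_power_linear_form:
  "\<exists>m. \<forall>u. (LINT x|sphere_measure. (u \<bullet> x)^n) = m * norm (u :: real^3) ^ n"
proof -
  define e where "e = (axis 1 1 :: real^3)"
  have [simp]: "norm e = 1" by (simp add: e_def)
  have "(LINT x|sphere_measure. (u \<bullet> x)^n) = (LINT x|sphere_measure. (e \<bullet> x)^n) * norm u ^ n" for u :: "real^3"
  proof -
    obtain T where T: "orthogonal_transformation T" "T (norm u *\<^sub>R e) = u"
      using orthogonal_transformation_exists[of "norm u *\<^sub>R e" u] by auto
    have meas: "T \<in> measurable sphere_measure sphere_measure"
      by (rule measurable_orthogonal_transformation[OF T(1)])
    have eq: "u \<bullet> T x = norm u * (e \<bullet> x)" for x
      using T(1) by (subst T(2)[symmetric]) (simp add: orthogonal_transformation_def)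
    have "(LINT x|sphere_measure. (u \<bullet> x)^n) = (LINT x|distr sphere_measure sphere_measure T. (u \<bullet> x)^n)"
      by (simp add: sphere_measure_orthogonal_transformation[OF T(1)])
    also have "\<dots> = (LINT x|sphere_measure. (u \<bullet> T x)^n)"
      by (rule integral_distr[OF meas])
       (intro borel_measurable_integrable integrable_sphere_measure continuous_intros)
    also have "\<dots> = (LINT x|sphere_measure. (e \<bullet> x)^n) * norm u ^ n"
      by (simp add: eq power_mult_distrib)
    finally show ?thesis .
  qed
  then show ?thesis by blast
qed

section \<open>Means over great circles\<close>

definition great_circle :: "'a::real_inner \<Rightarrow> 'a \<Rightarrow> real \<Rightarrow> 'a" where
  "great_circle x z s = cos s *\<^sub>R x + sin s *\<^sub>R z"

definition great_circle_mean :: "'a::real_inner \<Rightarrow> 'a \<Rightarrow> ('a \<Rightarrow> real) \<Rightarrow> real" where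
  "great_circle_mean x z f = integral {0..2*pi} (\<lambda>s. f (great_circle x z s)) / (2*pi)"

lemma continuous_great_circle [continuous_intros]: "continuous_on S (great_circle x z)"
  unfolding great_circle_def by (intro continuous_intros)

lemma continuous_comp_great_circle:
  "continuous_on UNIV f \<Longrightarrow> continuous_on S (\<lambda>s. f (great_circle x z s))"
  by (rule continuous_on_compose2[of UNIV f]) (auto intro: continuous_intros)

text \<open>
  Equally spaced points on a great circle satisfy a linear recurrence. It needs only the ring generated by
  \<open>2 cos t\<close>, which is \<open>\<int>\<close> for hexagons and \<open>\<int>[\<phi>]\<close> for decagons.
\<close>
lemma great_circle_recurrence:
  "great_circle x z (a + 2*t) = (2 * cos t) *\<^sub>R great_circle x z (a + t) - great_circle x z a"
proof -
  have "cos (a + 2*t) = 2 * cos t * cos (a + t) - cos a"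
       "sin (a + 2*t) = 2 * cos t * sin (a + t) - sin a"
    unfolding cos_add sin_add cos_double sin_double
    using sin_cos_squared_add[of t] by algebra+
  then show ?thesis
    by (simp add: great_circle_def scaleR_add_right scaleR_diff_left)
qed

text \<open>
  The derivative of \<open>f\<^sup>n\<^sup>+\<^sup>1 f'\<close> for \<open>f = A cos + B sin\<close> integrates to zero over a period, and
  \<open>f\<^sup>2 + f'\<^sup>2 = A\<^sup>2 + B\<^sup>2\<close> expresses it by powers of \<open>f\<close>.
\<close>
lemma integral_sinusoid_power:
  fixes A B :: real and n :: nat
  defines "f \<equiv> \<lambda>s. A * cos s + B * sin s"
  shows "(n + 2) * integral {0..2*pi} (\<lambda>s. f s ^ (n+2)) =
      (n + 1) * (A^2 + B^2) * integral {0..2*pi} (\<lambda>s. f s ^ n)"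
proof -
  define f' where "f' = (\<lambda>s. - A * sin s + B * cos s)"
  have int: "(\<lambda>s. f s ^ k) integrable_on {0..2*pi}" for k
    unfolding f_def by (intro integrable_continuous_interval continuous_intros)
  have sq: "f' s ^ 2 = A^2 + B^2 - f s ^ 2" for s
    unfolding f_def f'_def using sin_cos_squared_add[of s] by algebra
  have d: "((\<lambda>s. f s ^ (n+1) * f' s) has_vector_derivative
      (n+1) * (A^2 + B^2) * f s ^ n - (n+2) * f s ^ (n+2)) (at s within {0..2*pi})" for s
  proof -
    have df: "(f has_real_derivative f' s) (at s within {0..2*pi})"
      and df': "(f' has_real_derivative - f s) (at s within {0..2*pi})"
      unfolding f_def f'_def by (auto intro!: derivative_eq_intros)
    have "((\<lambda>s. f s ^ (n+1) * f' s) has_real_derivative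
        (n+1) * f s ^ n * f' s ^ 2 - f s ^ (n+2)) (at s within {0..2*pi})"
      by (rule DERIV_cong[OF DERIV_mult[OF DERIV_power[OF df, of "n+1"] df']])
        (simp add: power2_eq_square algebra_simps)
    also have "(n+1) * f s ^ n * f' s ^ 2 - f s ^ (n+2) =
        (n+1) * (A^2 + B^2) * f s ^ n - (n+2) * f s ^ (n+2)"
      unfolding sq by (simp add: power2_eq_square algebra_simps)
    finally show ?thesis
      by (simp add: has_real_derivative_iff_has_vector_derivative)
  qed
  have "((\<lambda>s. (n+1) * (A^2 + B^2) * f s ^ n - (n+2) * f s ^ (n+2)) has_integral
      f (2*pi) ^ (n+1) * f' (2*pi) - f 0 ^ (n+1) * f' 0) {0..2*pi}"
    by (rule fundamental_theorem_of_calculus) (use d in auto)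
  then have "((\<lambda>s. (n+1) * (A^2 + B^2) * f s ^ n - (n+2) * f s ^ (n+2)) has_integral 0) {0..2*pi}"
    by (simp add: f_def f'_def)
  moreover have "((\<lambda>s. (n+1) * (A^2 + B^2) * f s ^ n - (n+2) * f s ^ (n+2)) has_integral
      (n+1) * (A^2 + B^2) * integral {0..2*pi} (\<lambda>s. f s ^ n)
        - (n+2) * integral {0..2*pi} (\<lambda>s. f s ^ (n+2))) {0..2*pi}"
    by (intro has_integral_diff has_integral_mult_right integrable_integral int)
  ultimately have "0 = (n+1) * (A^2 + B^2) * integral {0..2*pi} (\<lambda>s. f s ^ n)
        - (n+2) * integral {0..2*pi} (\<lambda>s. f s ^ (n+2))"
    by (rule has_integral_unique)
  then show ?thesis
    by linarith
qed

lemma great_circle_mean_power: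
  fixes u x z :: "'a::real_inner"
  defines "R \<equiv> (u \<bullet> x)^2 + (u \<bullet> z)^2"
  shows "great_circle_mean x z (\<lambda>v. (u \<bullet> v)^4) = 3/8 * R^2"
    and "great_circle_mean x z (\<lambda>v. (u \<bullet> v)^8) = 35/128 * R^4"
    and "odd n \<Longrightarrow> great_circle_mean x z (\<lambda>v. (u \<bullet> v)^n) = 0"
proof -
  define M where "M n = great_circle_mean x z (\<lambda>v. (u \<bullet> v)^n)" for n
  have M: "M n = integral {0..2*pi} (\<lambda>s. ((u \<bullet> x) * cos s + (u \<bullet> z) * sin s) ^ n) / (2*pi)" for n
    by (simp add: M_def great_circle_mean_def great_circle_def inner_add_right mult.commute)
  have rec: "M (n+2) = (n+1) / (n+2) * R * M n" for n
  proof -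
    have "integral {0..2*pi} (\<lambda>s. ((u \<bullet> x) * cos s + (u \<bullet> z) * sin s) ^ (n+2)) = (n+1) / (n+2) * R *
        integral {0..2*pi} (\<lambda>s. ((u \<bullet> x) * cos s + (u \<bullet> z) * sin s) ^ n)"
      using integral_sinusoid_power[of n "u \<bullet> x" "u \<bullet> z", folded R_def]
      by (simp add: eq_divide_eq mult_ac del: power_Suc)
    then show ?thesis
      unfolding M by (simp add: add.commute)
  qed
  have M0: "M 0 = 1" by (simp add: M)
  have "M 2 = R / 2"
    using rec[of 0] M0 by (simp add: numeral_2_eq_2)
  moreover have "M 4 = 3/4 * R * M 2"
    using rec[of 2] by simp
  ultimately have M4: "M 4 = 3/8 * R^2"
    by (simp only: power2_eq_square)
  have "((\<lambda>s. (u \<bullet> x) * cos s + (u \<bullet> z) * sin s) has_integral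
      ((u \<bullet> x) * sin (2*pi) - (u \<bullet> z) * cos (2*pi)) - ((u \<bullet> x) * sin 0 - (u \<bullet> z) * cos 0)) {0..2*pi}"
    by (rule fundamental_theorem_of_calculus)
      (auto intro!: derivative_eq_intros simp: has_real_derivative_iff_has_vector_derivative[symmetric])
  then have M1: "M 1 = 0" by (simp add: M integral_unique)
  show "great_circle_mean x z (\<lambda>v. (u \<bullet> v)^4) = 3/8 * R^2"
    by (simp add: M_def[symmetric] M4)
  show "great_circle_mean x z (\<lambda>v. (u \<bullet> v)^8) = 35/128 * R^4"
  proof -
    have M6: "M 6 = 5/6 * R * M 4" and M8: "M 8 = 7/8 * R * M 6"
      using rec[of 4] rec[of 6] by simp_all
    show ?thesis
      unfolding M_def[symmetric] M8 M6 M4 by (simp add: power4_eq_xxxx power2_eq_square)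
  qed
  have "M (2*k+1) = 0" for k
  proof (induction k)
    case (Suc k)
    then show ?case using rec[of "2*k+1"] by simp
  qed (use M1 in simp)
  then show "great_circle_mean x z (\<lambda>v. (u \<bullet> v)^n) = 0" if "odd n"
    using that by (auto elim!: oddE simp: M_def)
qed

subsection \<open>Arcs of a great circle\<close>

context
  fixes x z :: "'a::real_inner"
  assumes frame: "norm x = 1" "norm z = 1" "x \<bullet> z = 0"
begin

lemma inner_great_circle: "great_circle x z a \<bullet> great_circle x z b = cos (b - a)"
  using frame by (simp add: great_circle_def inner_add_left inner_add_right norm_eq_1 inner_commute cos_diff)

lemma geodesic_great_circle:
  assumes "0 < b - a" "b - a < pi"
  shows "geodesic (great_circle x z a) (great_circle x z b) t = great_circle x z (a + t * (b - a))"
proof -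
  define d where "d = b - a"
  have b: "b = a + d" and d: "0 < d" "d < pi" "sin d > 0"
    using assms by (auto simp: d_def sin_gt_zero)
  have arc: "arccos (great_circle x z a \<bullet> great_circle x z b) = d"
    using d by (simp add: inner_great_circle arccos_cos d_def)
  have e: "(1-t)*d = d - t*d" by (simp add: algebra_simps)
  have "sin (d - t*d) * cos a + sin (t*d) * cos (a + d) = sin d * cos (a + t*d)"
       "sin (d - t*d) * sin a + sin (t*d) * sin (a + d) = sin d * sin (a + t*d)"
    unfolding sin_diff cos_add sin_add by algebra+
  then have c: "sin (d - t*d) / sin d * cos a + sin (t*d) / sin d * cos (a + d) = cos (a + t*d)"
       "sin (d - t*d) / sin d * sin a + sin (t*d) / sin d * sin (a + d) = sin (a + t*d)"
    using d(3) by (simp_all add: field_simps)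
  have "geodesic (great_circle x z a) (great_circle x z b) t =
     (sin (d - t*d) / sin d * cos a + sin (t*d) / sin d * cos (a + d)) *\<^sub>R x +
     (sin (d - t*d) / sin d * sin a + sin (t*d) / sin d * sin (a + d)) *\<^sub>R z"
    unfolding geodesic_def Let_def arc e by (simp add: great_circle_def b algebra_simps)
  also have "\<dots> = great_circle x z (a + t*d)"
    unfolding c great_circle_def ..
  finally show ?thesis by (simp add: d_def)
qed

end

text \<open>
  For an admissible arc this is the arc-length integral of \<open>f\<close>, rewritten so that the symmetry in the end
  points holds without any condition on them.
\<close>
definition arc_integral :: "('a::real_inner \<Rightarrow> real) \<Rightarrow> 'a \<Rightarrow> 'a \<Rightarrow> real" where
  "arc_integral f x y = arccos (x \<bullet> y) * integral {0..1} (\<lambda>t. f (geodesic x y t))"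

lemma arc_length_integral_geodesic:
  assumes "norm x = 1" "norm y = 1" "y \<noteq> x" "y \<noteq> - x"
  shows "arc_length_integral (geodesic x y) f = arc_integral f x y"
proof -
  have "arc_length_integral (geodesic x y) f = integral {0..1} (\<lambda>t. arccos (x \<bullet> y) * f (geodesic x y t))"
    unfolding arc_length_integral_def
    by (rule integral_cong) (simp add: norm_vector_derivative_geodesic[OF assms])
  then show ?thesis by (simp add: arc_integral_def)
qed

lemma arc_integral_commute: "arc_integral f x y = arc_integral f y x"
proof -
  have rev: "geodesic y x t = geodesic x y (1 - t)" for t
    by (simp add: geodesic_def Let_def inner_commute)
  have "integral {0..1} (\<lambda>t. f (geodesic x y (1 - t))) = integral {0..1} (\<lambda>t. f (geodesic x y t))"
    using Henstock_Kurzweil_Integration.integral_reflect_real[of 0 "-1" "\<lambda>t. f (geodesic x y (1 + t))"]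
      integral_shift_Icc_real[of "-1" 0 "\<lambda>t. f (geodesic x y t)" 1]
    by (simp add: o_def)
  then show ?thesis
    by (simp add: arc_integral_def rev inner_commute)
qed

lemma arc_integral_great_circle:
  assumes "norm x = 1" "norm z = 1" "x \<bullet> z = 0" and ab: "0 < b - a" "b - a < pi"
    and f: "continuous_on UNIV f"
  shows "arc_integral f (great_circle x z a) (great_circle x z b) =
      integral {a..b} (\<lambda>s. f (great_circle x z s))"
proof -
  have "((\<lambda>s. f (great_circle x z s)) has_integral
      integral {a..b} (\<lambda>s. f (great_circle x z s))) (cbox a b)"
    using f by (auto intro!: integrable_integral integrable_continuous_interval continuous_comp_great_circle)
  note has_integral_affinity[OF this, of "b - a" a]
  moreover have im: "(\<lambda>x. (1 / (b-a)) *\<^sub>R x + - ((1 / (b-a)) *\<^sub>R a)) ` cbox a b = {0..1}"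
    using ab by (subst image_affinity_cbox) (auto simp: diff_divide_distrib[symmetric])
  ultimately
  have "((\<lambda>t. f (great_circle x z ((b - a) * t + a))) has_integral
      integral {a..b} (\<lambda>s. f (great_circle x z s)) / (b - a)) {0..1}"
    using ab by (simp only: im) simp
  then have "integral {0..1} (\<lambda>t. f (great_circle x z ((b - a) * t + a))) =
      integral {a..b} (\<lambda>s. f (great_circle x z s)) / (b - a)"
    by (rule integral_unique)
  then show ?thesis
    using ab assms
    by (simp add: arc_integral_def geodesic_great_circle inner_great_circle arccos_cos add.commute mult.commute)
qed

section \<open>Integrals along Euler cycles\<close>

text \<open>
  The oriented edges: every edge of the graph is counted in both directions.
\<close>
definition edge_pairs :: "'a::real_inner set \<Rightarrow> real \<Rightarrow> ('a \<times> 'a) set" where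
  "edge_pairs V c = {(x, y). x \<in> V \<and> y \<in> V \<and> x \<bullet> y = c}"

lemma finite_edge_pairs: "finite V \<Longrightarrow> finite (edge_pairs V c)"
  by (rule finite_subset[of _ "V \<times> V"]) (auto simp: edge_pairs_def)

lemma steps_mem:
  assumes "(x, y) \<in> set (steps w)"
  shows "x \<in> set w" "y \<in> set w"
proof -
  show "x \<in> set w"
    using assms unfolding steps_def by (rule set_zip_leftD)
  have "y \<in> set (tl w)"
    using assms unfolding steps_def by (rule set_zip_rightD)
  then show "y \<in> set w"
    by (cases w) auto
qed

lemma set_subset_steps:
  assumes "2 \<le> length w"
  shows "set w \<subseteq> fst ` set (steps w) \<union> snd ` set (steps w)"
  using assms
proof (induction w)
  case (Cons a w)
  show ?case
  proof (cases w)
    case (Cons b v)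
    have "set w \<subseteq> insert b (fst ` set (steps w) \<union> snd ` set (steps w))"
      using Cons.IH by (cases v) (auto simp: Cons)
    then show ?thesis
      by (auto simp: Cons steps_def)
  qed (use Cons in auto)
qed simp

context
  fixes V :: "'a::real_inner set" and c :: real
  assumes V: "finite V" "V \<subseteq> sphere 0 1" and c: "\<bar>c\<bar> < 1" and nonempty: "edge_pairs V c \<noteq> {}"
begin

lemma edge_pairs_neq:
  assumes "(x, y) \<in> edge_pairs V c"
  shows "norm x = 1" "norm y = 1" "y \<noteq> x" "y \<noteq> - x"
proof -
  have xy: "x \<in> V" "y \<in> V" "x \<bullet> y = c"
    using assms by (auto simp: edge_pairs_def)
  then show "norm x = 1" "norm y = 1"
    using V(2) by auto
  then show "y \<noteq> x" "y \<noteq> - x"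
    using xy(3) c by (auto simp: dot_square_norm)
qed

text \<open>
  An Euler cycle uses each edge in exactly one of its two directions, so its steps and their reversals
  partition the oriented edges.
\<close>
lemma induced_cycle_steps:
  assumes "induced_cycle (edges_inner V c) \<gamma>"
  shows "set (steps \<gamma>) \<union> prod.swap ` set (steps \<gamma>) = edge_pairs V c"
    and "set (steps \<gamma>) \<inter> prod.swap ` set (steps \<gamma>) = {}"
    and "distinct (steps \<gamma>)"
    and "geodesic_cycle \<gamma>"
proof -
  let ?e = "\<lambda>(x, y). {x, y}" and ?S = "set (steps \<gamma>)"
  obtain w where w: "euler_cycle (edges_inner V c) w" "\<gamma> = map sgn w"
    using assms by (auto simp: induced_cycle_def)
  have E: "edges_inner V c = ?e ` edge_pairs V c"
    by (auto simp: edges_inner_def edge_pairs_def image_iff)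
  have sym: "(y, x) \<in> edge_pairs V c" if "(x, y) \<in> edge_pairs V c" for x y
    using that by (auto simp: edge_pairs_def inner_commute)
  have "?e ` set (steps w) = ?e ` edge_pairs V c"
    using w(1) by (simp add: euler_cycle_def E)
  then have sub: "?e p \<in> ?e ` edge_pairs V c" if "p \<in> set (steps w)" for p
    using that by blast
  have sub': "p \<in> edge_pairs V c" if p: "p \<in> set (steps w)" for p
    using sub[OF p] sym by (cases p) (auto simp: doubleton_eq_iff)
  have "steps w \<noteq> []"
    using w(1) nonempty unfolding euler_cycle_def E by auto
  then have len: "2 \<le> length w"
    by (cases w; cases "tl w") (auto simp: steps_def)
  have "set w \<subseteq> V"
    using set_subset_steps[OF len] sub' by (force simp: edge_pairs_def)
  then have "\<forall>x\<in>set w. sgn x = x"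
    using V(2) by (force simp: sgn_div_norm)
  then have \<gamma>: "\<gamma> = w"
    using w(2) by (simp add: map_idI)
  have dist: "distinct (map ?e (steps \<gamma>))" and img: "?e ` ?S = ?e ` edge_pairs V c"
    using w(1) by (simp_all add: euler_cycle_def E \<gamma>)
  then have inj: "inj_on ?e ?S"
    by (simp add: distinct_map)
  show "distinct (steps \<gamma>)"
    using dist by (simp add: distinct_map)
  show "?S \<union> prod.swap ` ?S = edge_pairs V c"
  proof
    show "?S \<union> prod.swap ` ?S \<subseteq> edge_pairs V c"
      using sub' sym unfolding \<gamma> by fastforce
    show "edge_pairs V c \<subseteq> ?S \<union> prod.swap ` ?S"
    proof
      fix p assume "p \<in> edge_pairs V c"
      then have "?e p \<in> ?e ` ?S" using img by blast
      then obtain q where "?e p = ?e q" "q \<in> ?S" by (rule imageE)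
      then have "p = q \<or> p = prod.swap q"
        by (auto simp: doubleton_eq_iff split: prod.splits)
      then show "p \<in> ?S \<union> prod.swap ` ?S"
        using \<open>q \<in> ?S\<close> by blast
    qed
  qed
  show "?S \<inter> prod.swap ` ?S = {}"
  proof (intro equals0I)
    fix p assume "p \<in> ?S \<inter> prod.swap ` ?S"
    then obtain x y where xy: "(x, y) \<in> ?S" "(y, x) \<in> ?S" by force
    then have "(x, y) = (y, x)"
      using inj by (auto dest!: inj_onD[where x = "(x, y)" and y = "(y, x)"])
    moreover have "(x, y) \<in> edge_pairs V c" using xy(1) sub' by (simp add: \<gamma>)
    ultimately show False
      using edge_pairs_neq(3) by auto
  qed
  show "geodesic_cycle \<gamma>"
    unfolding geodesic_cycle_def \<gamma>
  proof (intro conjI)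
    show "hd w = last w"
      using w(1) by (simp add: euler_cycle_def)
    show "set w \<subseteq> sphere 0 1"
      using \<open>set w \<subseteq> V\<close> V(2) by blast
    show "\<forall>(x, y)\<in>set (steps w). y \<noteq> x \<and> y \<noteq> - x"
      using edge_pairs_neq(3,4) sub' by fast
  qed (rule len)
qed

lemma cycle_integral_induced_cycle:
  assumes "induced_cycle (edges_inner V c) \<gamma>"
  shows "cycle_integral \<gamma> f = (\<Sum>(x, y)\<in>edge_pairs V c. arc_integral f x y) / 2"
proof -
  let ?S = "set (steps \<gamma>)"
  note steps = induced_cycle_steps[OF assms]
  have "cycle_integral \<gamma> f = (\<Sum>(x, y)\<leftarrow>steps \<gamma>. arc_integral f x y)"
    unfolding cycle_integral_def
  proof (intro arg_cong[of _ _ sum_list] map_cong refl, clarify)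
    fix x y assume "(x, y) \<in> ?S"
    then have "(x, y) \<in> edge_pairs V c"
      using steps(1) by blast
    then show "arc_length_integral (geodesic x y) f = arc_integral f x y"
      by (intro arc_length_integral_geodesic edge_pairs_neq)
  qed
  also have "\<dots> = (\<Sum>(x, y)\<in>?S. arc_integral f x y)"
    using steps(3) by (rule sum_list_distinct_conv_sum_set)
  finally have *: "cycle_integral \<gamma> f = (\<Sum>(x, y)\<in>?S. arc_integral f x y)" .
  have "(\<Sum>(x, y)\<in>prod.swap ` ?S. arc_integral f x y) = (\<Sum>(x, y)\<in>?S. arc_integral f x y)"
    by (subst sum.reindex) (auto intro!: sum.cong arc_integral_commute)
  then have "(\<Sum>(x, y)\<in>edge_pairs V c. arc_integral f x y) = 2 * (\<Sum>(x, y)\<in>?S. arc_integral f x y)"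
    unfolding steps(1)[symmetric] by (subst sum.union_disjoint) (auto simp: steps(2))
  then show ?thesis
    by (simp add: *)
qed

end

text \<open>
  The arc from \<open>x\<close> to \<open>y\<close> is followed on its great circle by the arc from \<open>y\<close> to \<open>2 cos t y - x\<close>, the
  image of \<open>x\<close> under the half-turn about \<open>y\<close>.
\<close>
definition next_arc :: "real \<Rightarrow> 'a::real_inner \<times> 'a \<Rightarrow> 'a \<times> 'a" where
  "next_arc t = (\<lambda>(x, y). (y, (2 * cos t) *\<^sub>R y - x))"

text \<open>
  The unit tangent vector at \<open>x\<close> of the arc of length \<open>t\<close> from \<open>x\<close> to \<open>y\<close>.
\<close>
definition frame :: "real \<Rightarrow> 'a::real_inner \<Rightarrow> 'a \<Rightarrow> 'a" where
  "frame t x y = (1 / sin t) *\<^sub>R (y - cos t *\<^sub>R x)"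

lemma frame:
  assumes "norm x = 1" "norm y = 1" "x \<bullet> y = cos t" "0 < t" "t < pi"
  shows "norm (frame t x y) = 1" "x \<bullet> frame t x y = 0" "great_circle x (frame t x y) t = y"
proof -
  have s: "sin t > 0" using assms by (intro sin_gt_zero)
  have xx: "x \<bullet> x = 1" and yy: "y \<bullet> y = 1"
    using assms by (simp_all add: dot_square_norm)
  have "frame t x y \<bullet> frame t x y = (1 - (cos t)^2) / (sin t)^2"
    by (simp add: frame_def inner_diff_left inner_diff_right xx yy assms(3) inner_commute power2_eq_square
      diff_divide_distrib)
  also have "\<dots> = 1"
    using s by (simp add: sin_squared_eq[symmetric])
  finally show "norm (frame t x y) = 1"
    by (simp add: norm_eq_1)
  show "x \<bullet> frame t x y = 0"
    by (simp add: frame_def inner_diff_right xx assms(3))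
  show "great_circle x (frame t x y) t = y"
    using s by (simp add: great_circle_def frame_def)
qed

lemma next_arc_iterate:
  assumes "norm x = 1" "norm y = 1" "x \<bullet> y = cos t" "0 < t" "t < pi"
  shows "(next_arc t ^^ k) (x, y) =
    (great_circle x (frame t x y) (k * t), great_circle x (frame t x y) ((k+1) * t))"
proof (induction k)
  case 0
  show ?case using frame(3)[OF assms] by (simp add: great_circle_def)
next
  case (Suc k)
  then show ?case
    using great_circle_recurrence[of x "frame t x y" "k*t" t]
    by (simp add: next_arc_def algebra_simps)
qed

lemma sum_arc_integral_great_circle:
  assumes "norm x = 1" "norm z = 1" "x \<bullet> z = 0" "0 < t" "t < pi" "continuous_on UNIV f"
  shows "(\<Sum>k<n. arc_integral f (great_circle x z (k * t)) (great_circle x z ((real k + 1) * t))) =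
    integral {0..n * t} (\<lambda>s. f (great_circle x z s))"
proof (induction n)
  case (Suc n)
  have "arc_integral f (great_circle x z (n * t)) (great_circle x z ((real n + 1) * t)) =
      integral {n*t..(real n+1)*t} (\<lambda>s. f (great_circle x z s))"
    using assms by (intro arc_integral_great_circle) (auto simp: algebra_simps)
  moreover have "integral {0..n*t} (\<lambda>s. f (great_circle x z s)) +
      integral {n*t..(real n+1)*t} (\<lambda>s. f (great_circle x z s)) =
      integral {0..(real n+1)*t} (\<lambda>s. f (great_circle x z s))"
    using assms by (intro Henstock_Kurzweil_Integration.integral_combine integrable_continuous_interval continuous_comp_great_circle)
      (auto simp: algebra_simps)
  ultimately show ?case
    using Suc by (simp add: add.commute)
qed simp

text \<open>
  Under the hypothesis \<open>turn\<close>, passing to the next arc permutes the oriented edges. The sum over all of them is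
  thus also the average of the sums over their first \<open>n\<close> successors, and \<open>n\<close> successive arcs form
  a full great circle.
\<close>
lemma sum_arc_integral_edge_pairs:
  fixes V :: "'a::real_inner set" and n :: nat and t :: real
  assumes V: "finite V" "V \<subseteq> sphere 0 1"
    and t: "0 < t" "t < pi" "n * t = 2 * pi"
    and turn: "\<And>x y. (x, y) \<in> edge_pairs V (cos t) \<Longrightarrow> (2 * cos t) *\<^sub>R y - x \<in> V"
    and f: "continuous_on UNIV f"
  shows "(\<Sum>(x, y)\<in>edge_pairs V (cos t). arc_integral f x y) =
    t * (\<Sum>(x, y)\<in>edge_pairs V (cos t). great_circle_mean x (frame t x y) f)"
proof -
  let ?P = "edge_pairs V (cos t)" and ?T = "next_arc t :: 'a \<times> 'a \<Rightarrow> 'a \<times> 'a"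
  let ?I = "\<lambda>(x, y). arc_integral f x y"
  have unit: "norm x = 1" "norm y = 1" "x \<bullet> y = cos t" if "(x, y) \<in> ?P" for x y
    using that V(2) by (auto simp: edge_pairs_def)
  have "?T ` ?P \<subseteq> ?P"
  proof (intro image_subsetI, clarify)
    fix x y assume xy: "(x, y) \<in> ?P"
    show "?T (x, y) \<in> ?P"
      using xy turn[OF xy] unit[OF xy]
      by (auto simp: next_arc_def edge_pairs_def inner_diff_right dot_square_norm inner_commute)
  qed
  moreover have "inj_on ?T ?P"
    by (auto simp: inj_on_def next_arc_def)
  ultimately have "bij_betw ?T ?P ?P"
    using finite_edge_pairs[OF V(1)] by (simp add: bij_betw_def endo_inj_surj)
  then have bij: "bij_betw (?T ^^ k) ?P ?P" for k
    by (rule bij_betw_funpow)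
  have "n * (\<Sum>p\<in>?P. ?I p) = (\<Sum>k<n. \<Sum>p\<in>?P. ?I ((?T ^^ k) p))"
    using sum.reindex_bij_betw[OF bij, of ?I] by simp
  also have "\<dots> = (\<Sum>p\<in>?P. \<Sum>k<n. ?I ((?T ^^ k) p))"
    by (rule sum.swap)
  also have "\<dots> = (\<Sum>(x, y)\<in>?P. 2 * pi * great_circle_mean x (frame t x y) f)"
  proof (intro sum.cong refl, clarify)
    fix x y assume "(x, y) \<in> ?P"
    note xy = unit[OF this] t(1,2)
    show "(\<Sum>k<n. ?I ((?T ^^ k) (x, y))) = 2 * pi * great_circle_mean x (frame t x y) f"
      using sum_arc_integral_great_circle[OF xy(1) frame(1,2)[OF xy] t(1,2) f, of n]
      by (simp add: next_arc_iterate[OF xy] t(3) great_circle_mean_def add.commute)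
  qed
  also have "\<dots> = n * (t * (\<Sum>(x, y)\<in>?P. great_circle_mean x (frame t x y) f))"
    by (simp add: t(3)[symmetric] sum_distrib_left case_prod_unfold mult.assoc)
  finally show ?thesis
    using t by auto
qed

lemma abs_cos_less_1:
  fixes t :: real
  assumes "0 < t" "t < pi"
  shows "\<bar>cos t\<bar> < 1"
  using zero_less_power[OF sin_gt_zero[OF assms], of 2]
  by (simp add: abs_square_less_1[symmetric] cos_squared_eq)

text \<open>
  For constant \<open>f\<close> the same summation gives the length of the cycle, so the length of the arcs cancels in the mean.
\<close>
lemma edge_mean:
  fixes V :: "'a::real_inner set" and n :: nat and t :: real
  assumes V: "finite V" "V \<subseteq> sphere 0 1" "edge_pairs V (cos t) \<noteq> {}"
    and t: "0 < t" "t < pi" "n * t = 2 * pi"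
    and turn: "\<And>x y. (x, y) \<in> edge_pairs V (cos t) \<Longrightarrow> (2 * cos t) *\<^sub>R y - x \<in> V"
    and f: "continuous_on UNIV f"
    and \<gamma>: "induced_cycle (edges_inner V (cos t)) \<gamma>"
  shows "cycle_integral \<gamma> f / cycle_length \<gamma> =
    (\<Sum>(x, y)\<in>edge_pairs V (cos t). great_circle_mean x (frame t x y) f) / card (edge_pairs V (cos t))"
    and "cycle_length \<gamma> > 0"
proof -
  have c: "\<bar>cos t\<bar> < 1"
    using t by (intro abs_cos_less_1)
  have eq: "cycle_integral \<gamma> g =
      t / 2 * (\<Sum>(x, y)\<in>edge_pairs V (cos t). great_circle_mean x (frame t x y) g)"
    if "continuous_on UNIV g" for g
    using cycle_integral_induced_cycle[OF V(1,2) c V(3) \<gamma>, of g]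
      sum_arc_integral_edge_pairs[OF V(1,2) t turn that] by simp
  have len: "cycle_length \<gamma> = t / 2 * card (edge_pairs V (cos t))"
    unfolding cycle_length_def by (simp add: eq great_circle_mean_def)
  have "card (edge_pairs V (cos t)) > 0"
    using V finite_edge_pairs by (simp add: card_gt_0_iff)
  then show "cycle_length \<gamma> > 0"
    unfolding len using t(1) by simp
  show "cycle_integral \<gamma> f / cycle_length \<gamma> =
    (\<Sum>(x, y)\<in>edge_pairs V (cos t). great_circle_mean x (frame t x y) f) / card (edge_pairs V (cos t))"
    unfolding len eq[OF f] using t(1) by simp
qed

lemma cycle_integral_cong:
  assumes \<gamma>: "geodesic_cycle \<gamma>" and "\<And>x. x \<in> sphere 0 1 \<Longrightarrow> f x = g x"
  shows "cycle_integral \<gamma> f = cycle_integral \<gamma> g"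
proof -
  have "arc_length_integral (geodesic x y) f = arc_length_integral (geodesic x y) g"
    if "(x, y) \<in> set (steps \<gamma>)" for x y
  proof -
    have "x \<in> set \<gamma>" "y \<in> set \<gamma>"
      using steps_mem[OF that] .
    then have "norm x = 1" "norm y = 1" "y \<noteq> x" "y \<noteq> - x"
      using \<gamma> that by (auto simp: geodesic_cycle_def)
    then have "norm (geodesic x y t) = 1" for t
      by (rule norm_geodesic)
    then show ?thesis
      using assms(2) by (simp add: arc_length_integral_def)
  qed
  then show ?thesis
    unfolding cycle_integral_def
    by (intro arg_cong[of _ _ sum_list] map_cong) auto
qed

text \<open>
  The frame projects \<open>u\<close> to the plane of \<open>x\<close> and \<open>y\<close>, whose unit normal is \<open>x \<times> y / sin t\<close>; the squared
  length of the projection is computed with the Gram determinant of \<open>u\<close>, \<open>x\<close>, \<open>y\<close>.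
\<close>
lemma great_circle_mean_power_cross:
  fixes u x y :: "real^3"
  assumes "norm x = 1" "norm y = 1" "x \<bullet> y = cos t" "0 < t" "t < pi"
  defines "R \<equiv> norm u ^ 2 - (u \<bullet> cross3 x y)^2 / (sin t)^2"
  shows "great_circle_mean x (frame t x y) (\<lambda>v. (u \<bullet> v)^4) = 3/8 * R^2"
    and "great_circle_mean x (frame t x y) (\<lambda>v. (u \<bullet> v)^8) = 35/128 * R^4"
proof -
  have s: "sin t > 0" using assms by (intro sin_gt_zero)
  \<comment> \<open>The determinant of the Gram matrix is the square of the triple product.\<close>
  have gram: "(u \<bullet> u) * ((x \<bullet> x) * (y \<bullet> y) - (x \<bullet> y)^2) - (u \<bullet> x)^2 * (y \<bullet> y) - (u \<bullet> y)^2 * (x \<bullet> x)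
      + 2 * (u \<bullet> x) * (u \<bullet> y) * (x \<bullet> y) = (u \<bullet> cross3 x y)^2"
    unfolding inner_3 cross3_def by (simp add: vector_3) algebra
  have "x \<bullet> x = 1" "y \<bullet> y = 1" and sc: "1 - (cos t)^2 = (sin t)^2"
    using assms by (simp_all add: dot_square_norm sin_squared_eq)
  then have "(u \<bullet> cross3 x y)^2 = (norm u)^2 * (sin t)^2 - (u \<bullet> x)^2 - (u \<bullet> y)^2 + 2 * (u \<bullet> x) * (u \<bullet> y) * cos t"
    using gram assms(3) by (simp add: power2_norm_eq_inner)
  moreover have "R * (sin t)^2 = (norm u)^2 * (sin t)^2 - (u \<bullet> cross3 x y)^2"
    using s by (simp add: R_def left_diff_distrib)
  ultimately have "R * (sin t)^2 = (u \<bullet> x)^2 + (u \<bullet> y)^2 - 2 * (u \<bullet> x) * (u \<bullet> y) * cos t"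
    by simp
  also have "\<dots> = (u \<bullet> x)^2 * (sin t)^2 + (u \<bullet> y - cos t * (u \<bullet> x))^2"
    unfolding sc[symmetric] by (simp add: power2_eq_square algebra_simps)
  also have "\<dots> = ((u \<bullet> x)^2 + (u \<bullet> frame t x y)^2) * (sin t)^2"
    using s by (simp add: frame_def inner_diff_right power_divide field_simps)
  finally have "R = (u \<bullet> x)^2 + (u \<bullet> frame t x y)^2"
    using s by simp
  then show "great_circle_mean x (frame t x y) (\<lambda>v. (u \<bullet> v)^4) = 3/8 * R^2"
    and "great_circle_mean x (frame t x y) (\<lambda>v. (u \<bullet> v)^8) = 35/128 * R^4"
    by (simp_all add: great_circle_mean_power)
qed

section \<open>A criterion for hybrid designs\<close>

lemma sphere_functional_sum:
  assumes "X \<subseteq> sphere 0 1"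
  shows "sphere_functional (\<lambda>f. \<Sum>x\<in>X. f x)"
  by unfold_locales (use assms in \<open>auto simp: sum.distrib sum_distrib_left intro!: sum.cong\<close>)

lemma sphere_functional_cycle_integral:
  fixes \<gamma> :: "(real^3) list"
  assumes \<gamma>: "geodesic_cycle \<gamma>"
  shows "sphere_functional (cycle_integral \<gamma>)"
proof -
  have arc: "arc_length_integral (geodesic x y) f = arc_integral f x y"
    "continuous_on UNIV f \<Longrightarrow> (\<lambda>t. f (geodesic x y t)) integrable_on {0..1}"
    if "(x, y) \<in> set (steps \<gamma>)" for x y f
  proof -
    have "x \<in> set \<gamma>" "y \<in> set \<gamma>"
      using steps_mem[OF that] .
    then have xy: "norm x = 1" "norm y = 1" "y \<noteq> x" "y \<noteq> - x"
      using \<gamma> that by (auto simp: geodesic_cycle_def)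
    then show "arc_length_integral (geodesic x y) f = arc_integral f x y"
      by (rule arc_length_integral_geodesic)
    assume f: "continuous_on UNIV f"
    have "continuous_on {0..1} (geodesic x y)"
      unfolding geodesic_def Let_def using sin_arccos_inner_pos[OF xy]
      by (intro continuous_intros) auto
    then show "(\<lambda>t. f (geodesic x y t)) integrable_on {0..1}"
      by (rule integrable_continuous_interval[OF continuous_on_compose2[OF f]]) simp
  qed
  have eq: "cycle_integral \<gamma> f = (\<Sum>(x, y)\<leftarrow>steps \<gamma>. arc_integral f x y)" for f
    unfolding cycle_integral_def using arc(1)
    by (intro arg_cong[of _ _ sum_list] map_cong) auto
  show ?thesis
  proof
    fix f g :: "real^3 \<Rightarrow> real"
    assume "continuous_on UNIV f" "continuous_on UNIV g"
    then have "arc_integral (\<lambda>x. f x + g x) x y = arc_integral f x y + arc_integral g x y"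
      if "(x, y) \<in> set (steps \<gamma>)" for x y
      using arc(2)[OF that] by (simp add: arc_integral_def integral_add distrib_left)
    then have "cycle_integral \<gamma> (\<lambda>x. f x + g x) =
        (\<Sum>(x, y)\<leftarrow>steps \<gamma>. arc_integral f x y + arc_integral g x y)"
      unfolding eq by (intro arg_cong[of _ _ sum_list] map_cong) auto
    then show "cycle_integral \<gamma> (\<lambda>x. f x + g x) = cycle_integral \<gamma> f + cycle_integral \<gamma> g"
      unfolding eq by (simp add: sum_list_addf case_prod_unfold)
  next
    fix f :: "real^3 \<Rightarrow> real" and c :: real
    show "cycle_integral \<gamma> (\<lambda>x. c * f x) = c * cycle_integral \<gamma> f"
      unfolding eq by (simp add: arc_integral_def sum_list_const_mult[symmetric] case_prod_unfold mult_ac)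
  qed (rule cycle_integral_cong[OF \<gamma>])
qed

text \<open>
  The symmetry of \<open>X\<close> removes its odd power sums, so a single identity in the even degree \<open>n\<close> is left.
\<close>
lemma hybrid_designI:
  fixes \<gamma> :: "(real^3) list"
  assumes \<beta>: "0 \<le> \<beta>" "\<beta> \<le> 1"
    and \<gamma>: "geodesic_cycle \<gamma>" "cycle_length \<gamma> > 0"
    and X: "finite X" "X \<noteq> {}" "X \<subseteq> sphere 0 1" "uminus ` X \<subseteq> X"
    and n: "even n"
    and even: "\<And>u. \<beta> / card X * (\<Sum>x\<in>X. (u \<bullet> x)^n) +
      (1 - \<beta>) * (cycle_integral \<gamma> (\<lambda>x. (u \<bullet> x)^n) / cycle_length \<gamma>) = c * norm u ^ n" "c \<noteq> 0"
    and odd: "\<And>u. cycle_integral \<gamma> (\<lambda>x. (u \<bullet> x)^(n+1)) = 0"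
  shows "hybrid_design (n+1) \<beta> \<gamma> X"
proof -
  let ?L = "\<lambda>f. \<beta> / card X * (\<Sum>x\<in>X. f x) + (1 - \<beta>) / cycle_length \<gamma> * cycle_integral \<gamma> f"
  interpret L: sphere_functional ?L
    by (intro sphere_functional_lincomb sphere_functional_sum sphere_functional_cycle_integral X(3) \<gamma>(1))
  have "uminus ` X = X"
    using X(1,4) by (intro card_subset_eq) (auto simp: card_image)
  then have "(\<Sum>x\<in>X. (u \<bullet> x)^(n+1)) = (\<Sum>x\<in>uminus ` X. (u \<bullet> x)^(n+1))" for u
    by simp
  also have "\<dots> u = - (\<Sum>x\<in>X. (u \<bullet> x)^(n+1))" for u
    using n by (subst sum.reindex) (auto simp: sum_negf)
  finally have X_odd: "(\<Sum>x\<in>X. (u \<bullet> x)^(n+1)) = 0" for u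
    by simp
  have "?L p = (LINT x|sphere_measure. p x)" if "p \<in> Pol (n+1)" for p
  proof (rule L.rotation_invariant_eq[OF sphere_functional_sphere_measure _ _ _ n even(2) _ _ that])
    show "?L (\<lambda>_. 1) = 1"
      using \<gamma>(2) X(1,2) by (simp add: cycle_length_def[symmetric] card_gt_0_iff)
    show "(LINT x|sphere_measure. 1) = (1::real)"
      by (simp add: measure_def space_sphere_measure emeasure_sphere_measure_sphere)
    show "?L (\<lambda>x. (u \<bullet> x)^n) = c * norm u ^ n" for u
      using even(1)[of u] by simp
    show "?L (\<lambda>x. (u \<bullet> x)^(n+1)) = 0" for u
      using X_odd[of u] odd[of u] by simp
  qed (rule sphere_mean_power_linear_form)
  then show ?thesis
    using \<beta> \<gamma> X unfolding hybrid_design_def by auto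
qed

section \<open>Points with coordinates in the ring of the golden ratio\<close>

lemma golden_square: "golden^2 = golden + 1"
  by (simp add: golden_def power2_eq_square field_simps)

lemma golden_bounds: "1 < golden" "golden < 2"
proof -
  have "sqrt 1 < sqrt 5" "sqrt 5 < sqrt 9"
    by (simp_all only: real_sqrt_less_iff)
  moreover have "sqrt 9 = (3::real)"
    by (rule real_sqrt_unique) auto
  ultimately show "1 < golden" "golden < 2"
    by (simp_all add: golden_def)
qed

lemma inverse_golden: "1 / golden = golden - 1"
  using golden_square golden_bounds by (simp add: field_simps power2_eq_square)

text \<open>
  With \<open>t = pi / 5\<close>, \<open>cos (3t) = - cos (2t)\<close> is a cubic equation for \<open>cos t\<close>; it has the factor
  \<open>cos t + 1\<close>, and the other factor splits over \<open>\<int>[\<phi>]\<close>.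
\<close>
lemma cos_pi_5: "cos (pi / 5) = golden / 2"
proof -
  define c where "c = cos (pi / 5)"
  have pos: "c > 0"
    unfolding c_def by (rule cos_gt_zero) auto
  have "cos (3 * (pi / 5)) = cos (pi - 2 * (pi / 5))"
    by (rule arg_cong[of _ _ cos]) simp
  also have "\<dots> = - cos (2 * (pi / 5))"
    by (simp only: cos_diff cos_pi sin_pi)
  finally have "4 * c^3 - 3 * c = 1 - 2 * c^2"
    by (simp only: cos_treble_cos cos_double_cos c_def)
  then have "(c + 1) * (4 * c^2 - 2 * c - 1) = 0"
    by algebra
  then have "4 * c^2 - 2 * c - 1 = 0"
    using pos by simp
  then have "(2 * c - golden) * (2 * c + golden - 1) = 0"
    using golden_square by algebra
  then show ?thesis
    using pos golden_bounds by (simp add: c_def)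
qed

text \<open>
  The pair \<open>(a, b)\<close> stands for \<open>a + b \<phi>\<close>. As \<open>\<phi>\<close> is irrational, equality in \<open>\<int>[\<phi>]\<close> is equality of integer
  pairs and can be decided by evaluation.
\<close>
type_synonym zphi = "int \<times> int"
type_synonym zvec = "zphi \<times> zphi \<times> zphi"

definition zval :: "zphi \<Rightarrow> real" where
  "zval a = real_of_int (fst a) + real_of_int (snd a) * golden"

definition zvec_val :: "zvec \<Rightarrow> real^3" where
  "zvec_val = (\<lambda>(a, b, c). vector [zval a, zval b, zval c])"

fun zsub :: "zphi \<Rightarrow> zphi \<Rightarrow> zphi" where
  "zsub (a, b) (c, d) = (a - c, b - d)"

fun zmul :: "zphi \<Rightarrow> zphi \<Rightarrow> zphi" where
  "zmul (a, b) (c, d) = (a * c + b * d, a * d + b * c + b * d)"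

definition zneg :: "zphi \<Rightarrow> zphi" where
  "zneg a = zsub (0, 0) a"

text \<open>
  The next vertex after \<open>p\<close>, \<open>q\<close> on a regular polygon inscribed in a great circle, where \<open>m\<close> represents twice
  the cosine of the angle between neighbours. For \<open>m = 0\<close> it is \<open>- p\<close>.
\<close>
fun znext :: "zphi \<Rightarrow> zvec \<Rightarrow> zvec \<Rightarrow> zvec" where
  "znext m (a, b, c) (a', b', c') = (zsub (zmul m a') a, zsub (zmul m b') b, zsub (zmul m c') c)"

fun zdot :: "zvec \<Rightarrow> zvec \<Rightarrow> zphi" where
  "zdot (a, b, c) (a', b', c') =
     zsub (zmul a a') (zsub (zneg (zmul b b')) (zmul c c'))"

fun zcross :: "zvec \<Rightarrow> zvec \<Rightarrow> zvec" where
  "zcross (a, b, c) (a', b', c') =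
     (zsub (zmul b c') (zmul c b'), zsub (zmul c a') (zmul a c'), zsub (zmul a b') (zmul b a'))"

lemma zval_zsub: "zval (zsub a b) = zval a - zval b"
  by (cases a; cases b) (simp add: zval_def algebra_simps)

lemma zval_zneg: "zval (zneg a) = - zval a"
  unfolding zneg_def zval_zsub by (simp add: zval_def)

lemma zval_zmul: "zval (zmul a b) = zval a * zval b"
proof -
  obtain a1 a2 b1 b2 where ab: "a = (a1, a2)" "b = (b1, b2)"
    by (cases a; cases b)
  show ?thesis
    unfolding ab zval_def using golden_square by simp algebra
qed

lemmas zval_simps = zval_zsub zval_zneg zval_zmul

lemma inner_zvec_val: "zvec_val p \<bullet> zvec_val q = zval (zdot p q)"
  by (cases p; cases q) (simp del: zsub.simps zmul.simps add: zvec_val_def inner_3 vector_3 zval_simps)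

lemma cross3_zvec_val: "cross3 (zvec_val p) (zvec_val q) = zvec_val (zcross p q)"
  by (cases p; cases q) (simp del: zsub.simps zmul.simps add: zvec_val_def cross3_def vector_3 zval_simps)

lemma zvec_val_znext: "zvec_val (znext m p q) = zval m *\<^sub>R zvec_val q - zvec_val p"
  by (cases p; cases q) (simp del: zsub.simps zmul.simps add: zvec_val_def vec_eq_iff forall_3 vector_3 zval_simps)

lemma sqrt_5_irrational: "sqrt 5 \<notin> \<rat>"
proof
  assume "sqrt 5 \<in> \<rat>"
  moreover have "algebraic_int (sqrt 5)"
    by (intro algebraic_int_sqrt) simp
  ultimately have "sqrt 5 \<in> \<int>"
    by (simp add: rational_algebraic_int_is_int)
  then obtain k where k: "sqrt 5 = real_of_int k"
    by (auto elim: Ints_cases)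
  have "2 < sqrt 5" "sqrt 5 < 3"
    by (auto intro!: real_less_rsqrt real_less_lsqrt)
  then show False
    unfolding k by simp
qed

lemma inj_zval: "inj zval"
proof (rule injI)
  fix a b assume "zval a = zval b"
  then have eq: "real_of_int (2 * (fst a - fst b) + (snd a - snd b)) = real_of_int (snd b - snd a) * sqrt 5"
    by (simp add: zval_def golden_def field_simps)
  have "snd a = snd b"
  proof (rule ccontr)
    assume "snd a \<noteq> snd b"
    then have "sqrt 5 = real_of_int (2 * (fst a - fst b) + (snd a - snd b)) / real_of_int (snd b - snd a)"
      using eq by (simp add: field_simps)
    then have "sqrt 5 \<in> \<rat>"
      by (metis Rats_divide Rats_of_int)
    then show False using sqrt_5_irrational by simp
  qed
  with eq show "a = b"
    by (simp add: prod_eq_iff)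
qed

lemma inj_zvec_val: "inj zvec_val"
  using inj_zval by (auto simp: inj_def zvec_val_def vec_eq_iff forall_3 vector_3)

text \<open>
  The radial projection to the sphere of a vector whose squared length is represented by \<open>e\<close>.
\<close>
definition zpoint :: "zphi \<Rightarrow> zvec \<Rightarrow> real^3" where
  "zpoint e p = (1 / sqrt (zval e)) *\<^sub>R zvec_val p"

lemma zpoint_eq_iff: "zval e > 0 \<Longrightarrow> zpoint e p = zpoint e q \<longleftrightarrow> p = q"
  by (simp add: zpoint_def inj_eq[OF inj_zvec_val])

lemma inner_zpoint: "zval e > 0 \<Longrightarrow> zpoint e p \<bullet> zpoint e q = zval (zdot p q) / zval e"
  by (simp add: zpoint_def inner_zvec_val real_sqrt_mult[symmetric])

text \<open>
  All vectors of the list have the same squared length, and the list is closed under negation.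
\<close>
definition spherical_codes :: "zphi \<Rightarrow> zvec list \<Rightarrow> bool" where
  "spherical_codes e ps \<longleftrightarrow> distinct ps \<and>
     list_all (\<lambda>p. zdot p p = e \<and> znext (0, 0) p p \<in> set ps) ps"

context
  fixes e :: zphi and ps :: "zvec list"
  assumes e: "zval e > 0" and ps: "spherical_codes e ps"
begin

lemma zpoint_sphere: "zpoint e ` set ps \<subseteq> sphere 0 1"
proof
  fix x assume "x \<in> zpoint e ` set ps"
  then obtain p where p: "p \<in> set ps" "x = zpoint e p"
    by (rule imageE)
  then have "zdot p p = e"
    using ps unfolding spherical_codes_def list_all_iff by blast
  then have "x \<bullet> x = 1"
    using e by (simp add: p(2) inner_zpoint[OF e])
  then show "x \<in> sphere 0 1"
    by (simp add: norm_eq_1)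
qed

lemma sum_zpoint: "(\<Sum>x\<in>zpoint e ` set ps. f x) = (\<Sum>p\<leftarrow>ps. f (zpoint e p))"
  using ps by (subst sum.reindex)
    (auto simp: spherical_codes_def inj_on_def zpoint_eq_iff[OF e] sum_list_distinct_conv_sum_set)

lemma card_zpoint: "card (zpoint e ` set ps) = length ps"
  using ps by (subst card_image) (auto simp: spherical_codes_def inj_on_def zpoint_eq_iff[OF e] distinct_card)

lemma uminus_zpoint: "uminus ` zpoint e ` set ps \<subseteq> zpoint e ` set ps"
proof clarify
  fix p assume "p \<in> set ps"
  then have "znext (0, 0) p p \<in> set ps"
    using ps unfolding spherical_codes_def list_all_iff by blast
  moreover have "- zpoint e p = zpoint e (znext (0, 0) p p)"
    by (simp add: zpoint_def zvec_val_znext zval_def)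
  ultimately show "- zpoint e p \<in> zpoint e ` set ps"
    by simp
qed

end

subsection \<open>Edge graphs\<close>

definition edge_list :: "zphi \<Rightarrow> zvec list \<Rightarrow> (zvec \<times> zvec) list" where
  "edge_list d ps = filter (\<lambda>(p, q). zdot p q = d) (List.product ps ps)"

text \<open>
  The properties of an edge graph that are decided by evaluation: the half-turns at the end points of the
  edges stay inside the vertex set, and the vector products of the oriented edges run through the list of
  normals \<open>k\<close> times. The list \<open>es\<close> of oriented edges is an argument so that simplification
  evaluates it once for both conditions.
\<close>
definition edge_check :: "zphi \<Rightarrow> zvec list \<Rightarrow> zvec list \<Rightarrow> nat \<Rightarrow> (zvec \<times> zvec) list \<Rightarrow> bool" where
  "edge_check m ps ns k es \<longleftrightarrow>
     list_all (\<lambda>(p, q). znext m p q \<in> set ps \<and> zcross p q \<in> set ns) es \<and>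
     list_all (\<lambda>n. count_list (map (\<lambda>(p, q). zcross p q) es) n = k) ns"

lemma sum_list_eq_sum_count:
  assumes "set xs \<subseteq> A" "finite A"
  shows "(\<Sum>x\<leftarrow>xs. f x) = (\<Sum>x\<in>A. real (count_list xs x) * f x)"
  using assms(1)
proof (induction xs)
  case (Cons y xs)
  have "(\<Sum>x\<in>A. real (count_list (y # xs) x) * f x) =
      (\<Sum>x\<in>A. real (count_list xs x) * f x + (if x = y then f x else 0))"
    by (intro sum.cong) (auto simp: algebra_simps)
  then show ?case
    using Cons assms(2) by (simp add: sum.distrib)
qed simp

context
  fixes e d m :: zphi and ps ns :: "zvec list" and t :: real and k :: nat
  assumes e: "zval e > 0" and ps: "spherical_codes e ps" and ns: "distinct ns" "ns \<noteq> []" "k > 0"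
    and t: "zval d = cos t * zval e" "zval m = 2 * cos t"
    and check: "edge_check m ps ns k (edge_list d ps)"
begin

lemma edge_pairs_zpoint:
  "edge_pairs (zpoint e ` set ps) (cos t) = (\<lambda>(p, q). (zpoint e p, zpoint e q)) ` set (edge_list d ps)"
proof -
  have "zpoint e p \<bullet> zpoint e q = cos t \<longleftrightarrow> zdot p q = d" for p q
  proof -
    have "zpoint e p \<bullet> zpoint e q = cos t \<longleftrightarrow> zval (zdot p q) = zval d"
      using e by (simp add: inner_zpoint t(1) field_simps)
    then show ?thesis
      by (simp add: inj_eq[OF inj_zval])
  qed
  then show ?thesis
    by (auto simp: edge_pairs_def edge_list_def)
qed

text \<open>
  Each normal belongs to one oriented great circle of the edge graph, which has \<open>k\<close> oriented edges.
\<close>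
lemma sum_cross3_edge_pairs:
  fixes h :: "real^3 \<Rightarrow> real"
  shows "(\<Sum>(x, y)\<in>edge_pairs (zpoint e ` set ps) (cos t). h (cross3 x y)) =
    k * (\<Sum>n\<leftarrow>ns. h ((1 / zval e) *\<^sub>R zvec_val n))"
proof -
  let ?es = "edge_list d ps" and ?H = "\<lambda>n. h ((1 / zval e) *\<^sub>R zvec_val n)"
  have cross: "cross3 (zpoint e p) (zpoint e q) = (1 / zval e) *\<^sub>R zvec_val (zcross p q)" for p q
    using e by (simp add: zpoint_def cross_mult_left cross_mult_right cross3_zvec_val)
  have dist: "distinct ?es"
    using ps by (simp add: edge_list_def spherical_codes_def distinct_product)
  have inj: "inj_on (\<lambda>(p, q). (zpoint e p, zpoint e q)) (set ?es)"
    by (rule inj_onI, rule prod.expand) (simp add: case_prod_unfold zpoint_eq_iff[OF e])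
  have "(\<Sum>(x, y)\<in>edge_pairs (zpoint e ` set ps) (cos t). h (cross3 x y)) = (\<Sum>(p, q)\<in>set ?es. ?H (zcross p q))"
    unfolding edge_pairs_zpoint by (subst sum.reindex[OF inj]) (auto simp: cross intro!: sum.cong)
  also have "\<dots> = (\<Sum>n\<leftarrow>map (\<lambda>(p, q). zcross p q) ?es. ?H n)"
    using dist by (simp add: sum_list_distinct_conv_sum_set case_prod_unfold o_def)
  also have "\<dots> = (\<Sum>n\<in>set ns. real k * ?H n)"
    using check by (subst sum_list_eq_sum_count[of _ "set ns"])
      (auto simp: edge_check_def list_all_iff intro!: sum.cong)
  also have "\<dots> = k * (\<Sum>n\<leftarrow>ns. ?H n)"
    using ns(1) by (simp add: sum_list_distinct_conv_sum_set sum_distrib_left)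
  finally show ?thesis .
qed

lemma card_edge_pairs_zpoint: "card (edge_pairs (zpoint e ` set ps) (cos t)) = k * length ns"
proof -
  have "real (card (edge_pairs (zpoint e ` set ps) (cos t))) = real (k * length ns)"
    using sum_cross3_edge_pairs[of "\<lambda>_. 1"] by (simp add: sum_list_triv case_prod_unfold)
  then show ?thesis
    by (simp only: of_nat_eq_iff)
qed

lemma turn_zpoint:
  assumes "(x, y) \<in> edge_pairs (zpoint e ` set ps) (cos t)"
  shows "(2 * cos t) *\<^sub>R y - x \<in> zpoint e ` set ps"
proof -
  obtain p q where pq: "(p, q) \<in> set (edge_list d ps)" "x = zpoint e p" "y = zpoint e q"
    using assms unfolding edge_pairs_zpoint by auto
  then have "znext m p q \<in> set ps"
    using check by (auto simp: edge_check_def list_all_iff)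
  moreover have "(2 * cos t) *\<^sub>R y - x = zpoint e (znext m p q)"
    by (simp add: pq(2,3) zpoint_def zvec_val_znext t(2) scaleR_diff_right)
  ultimately show ?thesis
    by simp
qed

context
  fixes N :: nat and \<gamma> :: "(real^3) list"
  assumes N: "0 < t" "t < pi" "N * t = 2 * pi"
    and \<gamma>: "induced_cycle (edges_inner (zpoint e ` set ps) (cos t)) \<gamma>"
begin

lemma edge_pairs_zpoint_nonempty: "edge_pairs (zpoint e ` set ps) (cos t) \<noteq> {}"
  using card_edge_pairs_zpoint ns by auto

lemmas edge_mean_zpoint =
  edge_mean[OF _ zpoint_sphere[OF e ps] edge_pairs_zpoint_nonempty N turn_zpoint _ \<gamma>, simplified]

lemma geodesic_cycle_zpoint: "geodesic_cycle \<gamma>"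
proof -
  have "\<bar>cos t\<bar> < 1"
    using N by (intro abs_cos_less_1)
  then show ?thesis
    using induced_cycle_steps(4)[OF _ zpoint_sphere[OF e ps] _ edge_pairs_zpoint_nonempty \<gamma>] by simp
qed

lemma cycle_length_zpoint: "cycle_length \<gamma> > 0"
  using edge_mean_zpoint(2)[of "\<lambda>_. 0"] by simp

text \<open>
  The values \<open>3/8\<close> and \<open>35/128\<close> are the means of \<open>cos\<^sup>4\<close> and \<open>cos\<^sup>8\<close> over a period.
\<close>
lemma edge_mean_power:
  defines "R \<equiv> \<lambda>u n. norm u ^ 2 - (u \<bullet> zvec_val n)^2 / (zval e * sin t)^2"
  shows "cycle_integral \<gamma> (\<lambda>x. (u \<bullet> x)^4) / cycle_length \<gamma> = 3/8 * (\<Sum>n\<leftarrow>ns. R u n ^ 2) / length ns"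
    and "cycle_integral \<gamma> (\<lambda>x. (u \<bullet> x)^8) / cycle_length \<gamma> = 35/128 * (\<Sum>n\<leftarrow>ns. R u n ^ 4) / length ns"
    and "odd j \<Longrightarrow> cycle_integral \<gamma> (\<lambda>x. (u \<bullet> x)^j) = 0"
proof -
  let ?P = "edge_pairs (zpoint e ` set ps) (cos t)"
  have mean: "cycle_integral \<gamma> (\<lambda>x. (u \<bullet> x)^j) / cycle_length \<gamma> =
      (\<Sum>(x, y)\<in>?P. great_circle_mean x (frame t x y) (\<lambda>x. (u \<bullet> x)^j)) / (k * length ns)" for j
    by (subst edge_mean_zpoint(1)) (auto intro!: continuous_intros simp: card_edge_pairs_zpoint)
  have unit: "norm x = 1" "norm y = 1" "x \<bullet> y = cos t" if "(x, y) \<in> ?P" for x y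
    using that zpoint_sphere[OF e ps] by (auto simp: edge_pairs_def)
  have R: "norm u ^ 2 - (u \<bullet> (1 / zval e) *\<^sub>R zvec_val n)^2 / (sin t)^2 = R u n" for n
    using e by (simp add: R_def power_mult_distrib power_divide)
  have "(\<Sum>(x, y)\<in>?P. great_circle_mean x (frame t x y) (\<lambda>x. (u \<bullet> x)^4)) =
      (\<Sum>(x, y)\<in>?P. 3/8 * (norm u ^ 2 - (u \<bullet> cross3 x y)^2 / (sin t)^2)^2)"
    using great_circle_mean_power_cross(1) unit N by (intro sum.cong) auto
  also have "\<dots> = k * (\<Sum>n\<leftarrow>ns. 3/8 * R u n ^ 2)"
    unfolding R[symmetric] by (rule sum_cross3_edge_pairs)
  also have "\<dots> = k * (3/8 * (\<Sum>n\<leftarrow>ns. R u n ^ 2))"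
    by (simp only: sum_list_const_mult)
  finally have *: "(\<Sum>(x, y)\<in>?P. great_circle_mean x (frame t x y) (\<lambda>x. (u \<bullet> x)^4)) =
      k * (3/8 * (\<Sum>n\<leftarrow>ns. R u n ^ 2))" .
  show "cycle_integral \<gamma> (\<lambda>x. (u \<bullet> x)^4) / cycle_length \<gamma> = 3/8 * (\<Sum>n\<leftarrow>ns. R u n ^ 2) / length ns"
    unfolding mean * using ns by simp
  have "(\<Sum>(x, y)\<in>?P. great_circle_mean x (frame t x y) (\<lambda>x. (u \<bullet> x)^8)) =
      (\<Sum>(x, y)\<in>?P. 35/128 * (norm u ^ 2 - (u \<bullet> cross3 x y)^2 / (sin t)^2)^4)"
    using great_circle_mean_power_cross(2) unit N by (intro sum.cong) auto
  also have "\<dots> = k * (\<Sum>n\<leftarrow>ns. 35/128 * R u n ^ 4)"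
    unfolding R[symmetric] by (rule sum_cross3_edge_pairs)
  also have "\<dots> = k * (35/128 * (\<Sum>n\<leftarrow>ns. R u n ^ 4))"
    by (simp only: sum_list_const_mult)
  finally have *: "(\<Sum>(x, y)\<in>?P. great_circle_mean x (frame t x y) (\<lambda>x. (u \<bullet> x)^8)) =
      k * (35/128 * (\<Sum>n\<leftarrow>ns. R u n ^ 4))" .
  show "cycle_integral \<gamma> (\<lambda>x. (u \<bullet> x)^8) / cycle_length \<gamma> = 35/128 * (\<Sum>n\<leftarrow>ns. R u n ^ 4) / length ns"
    unfolding mean * using ns by simp
  show "cycle_integral \<gamma> (\<lambda>x. (u \<bullet> x)^j) = 0" if "odd j"
    using mean[of j] cycle_length_zpoint that by (simp add: great_circle_mean_power(3) case_prod_unfold)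
qed

end

end

section \<open>The polytopes\<close>

fun zsigns :: "zvec \<Rightarrow> zvec list" where
  "zsigns (a, b, c) = [(x, y, z). x \<leftarrow> [a, zneg a], y \<leftarrow> [b, zneg b], z \<leftarrow> [c, zneg c]]"

fun zcyclic :: "zvec \<Rightarrow> zvec list" where
  "zcyclic (a, b, c) = [(a, b, c), (b, c, a), (c, a, b)]"

text \<open>
  The orbit under all sign changes and cyclic permutations of the coordinates. This symmetry is shared by
  the standard positions of all polytopes that occur here.
\<close>
definition orbit :: "zvec \<Rightarrow> zvec list" where
  "orbit p = remdups (concat (map zcyclic (zsigns p)))"

lemma sign_changes_3:
  fixes x y z :: real
  shows "sign_changes (vector [x, y, z] :: real^3) =
    {vector [x, y, z], vector [x, y, - z], vector [x, - y, z], vector [x, - y, - z],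
     vector [- x, y, z], vector [- x, y, - z], vector [- x, - y, z], vector [- x, - y, - z]}"
    (is "?L = ?R")
proof (intro equalityI subsetI)
  fix w :: "real^3" assume "w \<in> ?L"
  then have "w = vector [w$1, w$2, w$3]" "w$1 \<in> {x, - x}" "w$2 \<in> {y, - y}" "w$3 \<in> {z, - z}"
    by (simp_all add: sign_changes_def forall_3 vec_eq_iff vector_3)
  then show "w \<in> ?R" by (metis insert_iff empty_iff)
qed (auto simp: sign_changes_def forall_3 vector_3)

lemma zvec_val_orbit:
  "zvec_val ` set (orbit p) = (\<Union>u\<in>sign_changes (zvec_val p). even_coord_perms u)"
proof -
  obtain a b c where p: "p = (a, b, c)" by (cases p)
  have cyc: "zvec_val ` set (zcyclic q) = even_coord_perms (zvec_val q)" for q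
    by (cases q) (simp add: zvec_val_def even_coord_perms_3)
  have signs: "zvec_val ` set (zsigns p) = sign_changes (zvec_val p)"
    unfolding p by (simp add: zvec_val_def sign_changes_3 zval_zneg)
  have "zvec_val ` set (orbit p) = (\<Union>q\<in>set (zsigns p). zvec_val ` set (zcyclic q))"
    by (simp only: orbit_def set_remdups set_concat set_map image_UN image_image)
  also have "\<dots> = (\<Union>u\<in>zvec_val ` set (zsigns p). even_coord_perms u)"
    by (simp only: cyc image_image)
  finally show ?thesis
    by (simp only: signs)
qed

lemma zpoint_orbit:
  "zpoint e ` set (orbit p) =
    (\<lambda>v. (1 / sqrt (zval e)) *\<^sub>R v) ` (\<Union>u\<in>sign_changes (zvec_val p). even_coord_perms u)"
  unfolding zvec_val_orbit[symmetric] image_image zpoint_def ..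

lemma zvec_val_eval: "zvec_val (a, b, c) = vector [zval a, zval b, zval c]"
  by (simp add: zvec_val_def)

lemma zval_eval: "zval (a, b) = real_of_int a + real_of_int b * golden"
  by (simp add: zval_def)

text \<open>
  The codes of the icosidodecahedron are doubled, which clears the denominators of the second orbit.
  The entries \<open>(-1, 1)\<close> represent \<open>\<phi> - 1 = 1 / \<phi>\<close>.
\<close>
definition "octahedron_codes = orbit ((1, 0), (0, 0), (0, 0))"
definition "cube_codes = orbit ((1, 0), (1, 0), (1, 0))"
definition "cuboctahedron_codes = orbit ((1, 0), (1, 0), (0, 0))"
definition "icosahedron_codes = orbit ((0, 1), (1, 0), (0, 0))"
definition "dodecahedron_codes = cube_codes @ orbit ((0, 1), (0, 0), (-1, 1))"
definition "icosidodecahedron_codes = orbit ((2, 0), (0, 0), (0, 0)) @ orbit ((0, 1), (-1, 1), (1, 0))"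

text \<open>
  Multiples of the vertices of the icosahedron: \<open>(0, 2, 2 (\<phi> - 1)) = 2 (\<phi> - 1) (0, \<phi>, 1)\<close>. They are
  kept in the scaling in which they arise as vector products.
\<close>
definition "decagon_normals = orbit ((0, 0), (2, 0), (-2, 2))"

lemma octahedron_vertices_eq:
  "octahedron_vertices = {vector [1, 0, 0], vector [0, 1, 0], vector [0, 0, 1],
    vector [-1, 0, 0], vector [0, -1, 0], vector [0, 0, -1]}"
  unfolding octahedron_vertices_def full_SetCompr_eq UNIV_3
    by (simp add: image_def axis_def vec_lambda_3 vec_eq_iff forall_3 vector_3 set_eq_iff)

lemma octahedron_zpoint: "octahedron_vertices = zpoint (1, 0) ` set octahedron_codes"
proof -
  have "octahedron_vertices = (\<Union>u\<in>sign_changes (vector [1, 0, 0]). even_coord_perms u)"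
    unfolding sign_changes_3 octahedron_vertices_eq by (auto simp: even_coord_perms_3)
  then show ?thesis
    by (simp add: octahedron_codes_def zpoint_orbit zvec_val_eval zval_eval)
qed

lemma cube_zpoint: "cube_vertices = zpoint (3, 0) ` set cube_codes"
proof -
  have "sign_changes (vector [1, 1, 1] :: real^3) = (\<Union>u\<in>sign_changes (vector [1, 1, 1]). even_coord_perms u)"
    unfolding sign_changes_3 by (auto simp: even_coord_perms_3)
  then show ?thesis
    by (simp add: cube_vertices_def cube_codes_def zpoint_orbit zvec_val_eval zval_eval)
qed

lemma cuboctahedron_zpoint: "cuboctahedron_vertices = zpoint (2, 0) ` set cuboctahedron_codes"
proof -
  have "(\<Union>u\<in>sign_changes (vector [1, 1, 0] :: real^3). coord_perms u) =
      (\<Union>u\<in>sign_changes (vector [1, 1, 0]). even_coord_perms u)"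
    unfolding sign_changes_3 by (auto simp: even_coord_perms_3 coord_perms_3)
  then show ?thesis
    by (simp add: cuboctahedron_vertices_def cuboctahedron_codes_def zpoint_orbit zvec_val_eval zval_eval)
qed

lemma icosahedron_zpoint: "icosahedron_vertices = zpoint (2, 1) ` set icosahedron_codes"
proof -
  have "1 + golden^2 = 2 + golden"
    by (simp add: golden_square)
  then show ?thesis
    by (simp add: icosahedron_vertices_def icosahedron_codes_def zpoint_orbit zvec_val_eval zval_eval)
qed

lemma dodecahedron_zpoint: "dodecahedron_vertices = zpoint (3, 0) ` set dodecahedron_codes"
  by (simp add: dodecahedron_vertices_def dodecahedron_codes_def cube_zpoint image_Un
      zpoint_orbit zvec_val_eval zval_eval inverse_golden add.commute[of "-1"])

lemma icosidodecahedron_zpoint: "icosidodecahedron_vertices = zpoint (4, 0) ` set icosidodecahedron_codes"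
proof -
  have scale: "r *\<^sub>R vector [x, y, z] = (vector [r * x, r * y, r * z] :: real^3)" for r x y z
    by (simp add: vec_eq_iff forall_3 vector_3)
  have "zpoint (4, 0) ` set (orbit ((2, 0), (0, 0), (0, 0))) = octahedron_vertices"
    by (simp add: zpoint_orbit zvec_val_eval zval_eval sign_changes_3 even_coord_perms_3 scale
        octahedron_vertices_eq insert_commute)
  moreover have "sqrt (4::real) = 2" by simp
  ultimately show ?thesis
    by (simp add: icosidodecahedron_vertices_def icosidodecahedron_codes_def image_Un
      zpoint_orbit zvec_val_eval zval_eval inverse_golden add.commute[of "-1"])
qed

lemma spherical_codes:
  "spherical_codes (1, 0) octahedron_codes" "spherical_codes (3, 0) cube_codes"
  "spherical_codes (2, 0) cuboctahedron_codes" "spherical_codes (2, 1) icosahedron_codes"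
  "spherical_codes (3, 0) dodecahedron_codes" "spherical_codes (4, 0) icosidodecahedron_codes"
  by code_simp+

text \<open>
  The edges form 4 regular hexagons. Their oriented axes are the 8 vertices of the cube, and an oriented
  hexagon has 6 edges.
\<close>
lemma cuboctahedron_edge_check:
  "edge_check (1, 0) cuboctahedron_codes cube_codes 6 (edge_list (1, 0) cuboctahedron_codes)"
  by code_simp

text \<open>
  The edges form 6 regular decagons, with 12 oriented axes. The inner product \<open>\<phi> / 2\<close> of neighbours becomes
  \<open>2 \<phi>\<close> in the doubled codes.
\<close>
lemma icosidodecahedron_edge_check:
  "edge_check (0, 1) icosidodecahedron_codes decagon_normals 10 (edge_list (0, 2) icosidodecahedron_codes)"
  by code_simp

lemma length_codes:
  "length octahedron_codes = 6" "length cube_codes = 8" "length icosahedron_codes = 12"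
  "length dodecahedron_codes = 20" "length decagon_normals = 12"
  by code_simp+

lemma distinct_normals: "distinct cube_codes" "distinct decagon_normals"
  by (simp_all only: cube_codes_def decagon_normals_def orbit_def distinct_remdups)

section \<open>Means over the edges of the two polytopes\<close>

lemma golden_ring_inverses:
  "1 / (2 + golden)^4 = (5 - 3 * golden) / 25" "1 / (3 - golden) = (2 + golden) / 5"
proof -
  have "(2 + golden)^4 * (5 - 3 * golden) = 25" "(3 - golden) * (2 + golden) = 5"
    using golden_square by algebra+
  then show "1 / (2 + golden)^4 = (5 - 3 * golden) / 25" "1 / (3 - golden) = (2 + golden) / 5"
    using golden_bounds by (simp_all add: field_simps)
qed

lemma zval_pos: "zval (1, 0) > 0" "zval (2, 0) > 0" "zval (3, 0) > 0" "zval (4, 0) > 0" "zval (2, 1) > 0"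
  using golden_bounds by (simp_all add: zval_eval)

lemma cuboctahedron_cycle:
  assumes "induced_cycle cuboctahedron_edges \<gamma>"
  shows "geodesic_cycle \<gamma>" and "cycle_length \<gamma> > 0"
    and "cycle_integral \<gamma> (\<lambda>x. (u \<bullet> x)^4) / cycle_length \<gamma> =
      3/8 * (\<Sum>p\<leftarrow>cube_codes. (norm u ^ 2 - (u \<bullet> zvec_val p)^2 / 3)^2) / 8"
    and "odd j \<Longrightarrow> cycle_integral \<gamma> (\<lambda>x. (u \<bullet> x)^j) = 0"
proof -
  have t: "zval (1, 0) = cos (pi/3) * zval (2, 0)" "zval (1, 0) = 2 * cos (pi/3)"
    by (simp_all add: zval_eval cos_60)
  have \<gamma>: "induced_cycle (edges_inner (zpoint (2, 0) ` set cuboctahedron_codes) (cos (pi/3))) \<gamma>"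
    using assms by (simp add: cuboctahedron_edges_def cuboctahedron_zpoint cos_60)
  have N: "0 < pi/3" "pi/3 < pi" "real 6 * (pi/3) = 2 * pi"
    by auto
  have ns: "cube_codes \<noteq> []" "0 < (6::nat)"
    using length_codes(2) by auto
  note * = zval_pos(2) spherical_codes(3) distinct_normals(1) ns t cuboctahedron_edge_check N \<gamma>
  have R: "(zval (2, 0) * sin (pi/3))^2 = 3"
    by (simp add: zval_eval sin_60 power_mult_distrib power_divide)
  show "geodesic_cycle \<gamma>" "cycle_length \<gamma> > 0"
    using geodesic_cycle_zpoint[OF *] cycle_length_zpoint[OF *] by auto
  show "cycle_integral \<gamma> (\<lambda>x. (u \<bullet> x)^4) / cycle_length \<gamma> =
      3/8 * (\<Sum>p\<leftarrow>cube_codes. (norm u ^ 2 - (u \<bullet> zvec_val p)^2 / 3)^2) / 8"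
    using edge_mean_power(1)[OF *, of u] by (simp only: R length_codes of_nat_numeral)
  show "odd j \<Longrightarrow> cycle_integral \<gamma> (\<lambda>x. (u \<bullet> x)^j) = 0"
    by (rule edge_mean_power(3)[OF *])
qed

lemma icosidodecahedron_cycle:
  assumes "induced_cycle icosidodecahedron_edges \<gamma>"
  shows "geodesic_cycle \<gamma>" and "cycle_length \<gamma> > 0"
    and "cycle_integral \<gamma> (\<lambda>x. (u \<bullet> x)^8) / cycle_length \<gamma> =
      35/128 * (\<Sum>p\<leftarrow>decagon_normals. (norm u ^ 2 - (2 + golden) / 20 * (u \<bullet> zvec_val p)^2)^4) / 12"
    and "odd j \<Longrightarrow> cycle_integral \<gamma> (\<lambda>x. (u \<bullet> x)^j) = 0"
proof -
  have t: "zval (0, 2) = cos (pi/5) * zval (4, 0)" "zval (0, 1) = 2 * cos (pi/5)"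
    by (simp_all add: zval_eval cos_pi_5)
  have \<gamma>: "induced_cycle (edges_inner (zpoint (4, 0) ` set icosidodecahedron_codes) (cos (pi/5))) \<gamma>"
    using assms by (simp add: icosidodecahedron_edges_def icosidodecahedron_zpoint cos_pi_5)
  have N: "0 < pi/5" "pi/5 < pi" "real 10 * (pi/5) = 2 * pi"
    by auto
  have ns: "decagon_normals \<noteq> []" "0 < (10::nat)"
    using length_codes(5) by auto
  note * = zval_pos(4) spherical_codes(6) distinct_normals(2) ns t icosidodecahedron_edge_check N \<gamma>
  have "(zval (4, 0) * sin (pi/5))^2 = 16 * (1 - (golden / 2)^2)"
    by (simp add: zval_eval power_mult_distrib sin_squared_eq cos_pi_5)
  also have "\<dots> = 4 * (3 - golden)"
    by (simp only: power_divide golden_square) (simp add: field_simps)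
  finally have R: "x / (zval (4, 0) * sin (pi/5))^2 = (2 + golden) / 20 * x" for x
    using arg_cong[OF golden_ring_inverses(2), of "\<lambda>y. x * y / 4"] by (simp add: mult_ac)
  show "geodesic_cycle \<gamma>" "cycle_length \<gamma> > 0"
    using geodesic_cycle_zpoint[OF *] cycle_length_zpoint[OF *] by auto
  show "cycle_integral \<gamma> (\<lambda>x. (u \<bullet> x)^8) / cycle_length \<gamma> =
      35/128 * (\<Sum>p\<leftarrow>decagon_normals. (norm u ^ 2 - (2 + golden) / 20 * (u \<bullet> zvec_val p)^2)^4) / 12"
    using edge_mean_power(2)[OF *, of u] by (simp only: R length_codes of_nat_numeral)
  show "odd j \<Longrightarrow> cycle_integral \<gamma> (\<lambda>x. (u \<bullet> x)^j) = 0"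
    by (rule edge_mean_power(3)[OF *])
qed

section \<open>Vertex sums and polynomial identities\<close>

lemmas code_eval = orbit_def zneg_def zvec_val_eval zval_eval inner_3 vector_3

lemma octahedron_sum:
  "even n \<Longrightarrow> (\<Sum>p\<leftarrow>octahedron_codes. (u \<bullet> zvec_val p)^n) = 2 * ((u$1)^n + (u$2)^n + (u$3)^n)"
  by (simp add: octahedron_codes_def code_eval)

lemma cube_sum:
  "(\<Sum>p\<leftarrow>cube_codes. f (u \<bullet> zvec_val p)) =
    f (u$1 + u$2 + u$3) + f (u$1 + u$2 - u$3) + f (u$1 - u$2 + u$3) + f (u$1 - u$2 - u$3) +
    f (- u$1 + u$2 + u$3) + f (- u$1 + u$2 - u$3) + f (- u$1 - u$2 + u$3) + f (- u$1 - u$2 - u$3)"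
  for f :: "real \<Rightarrow> real"
  by (simp add: cube_codes_def code_eval)

lemma icosahedron_sum:
  "(\<Sum>p\<leftarrow>icosahedron_codes. (u \<bullet> zvec_val p)^8) =
    2 * ((golden * u$1 + u$2)^8 + (golden * u$1 - u$2)^8 + (golden * u$2 + u$3)^8 +
      (golden * u$2 - u$3)^8 + (golden * u$3 + u$1)^8 + (golden * u$3 - u$1)^8)"
  by (simp add: icosahedron_codes_def code_eval) algebra

lemma dodecahedron_sum:
  "(\<Sum>p\<leftarrow>dodecahedron_codes. (u \<bullet> zvec_val p)^8) =
    2 * ((u$1 + u$2 + u$3)^8 + (u$1 + u$2 - u$3)^8 + (u$1 - u$2 + u$3)^8 + (u$1 - u$2 - u$3)^8 +
      (golden * u$1 + (golden-1) * u$3)^8 + (golden * u$1 - (golden-1) * u$3)^8 +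
      (golden * u$2 + (golden-1) * u$1)^8 + (golden * u$2 - (golden-1) * u$1)^8 +
      (golden * u$3 + (golden-1) * u$2)^8 + (golden * u$3 - (golden-1) * u$2)^8)"
  by (simp add: dodecahedron_codes_def cube_codes_def code_eval) algebra

lemma decagon_sum:
  fixes u :: "real^3" and r k :: real
  shows "(\<Sum>p\<leftarrow>decagon_normals. (r - k * (u \<bullet> zvec_val p)^2)^4) =
   2 * ((r - 4 * k * (u$2 + (golden-1) * u$3)^2)^4 + (r - 4 * k * (u$2 - (golden-1) * u$3)^2)^4 +
    (r - 4 * k * (u$3 + (golden-1) * u$1)^2)^4 + (r - 4 * k * (u$3 - (golden-1) * u$1)^2)^4 +
    (r - 4 * k * (u$1 + (golden-1) * u$2)^2)^4 + (r - 4 * k * (u$1 - (golden-1) * u$2)^2)^4)"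
  by (simp add: decagon_normals_def code_eval) algebra

lemma sum_power_zpoint:
  assumes "zval e > 0" "spherical_codes e ps"
  shows "(\<Sum>x\<in>zpoint e ` set ps. (u \<bullet> x)^(2*m)) = (\<Sum>p\<leftarrow>ps. (u \<bullet> zvec_val p)^(2*m)) / zval e ^ m"
proof -
  have "(u \<bullet> zpoint e p)^(2*m) = inverse (zval e ^ m) * (u \<bullet> zvec_val p)^(2*m)" for p
  proof -
    have "sqrt (zval e) ^ (2*m) = zval e ^ m"
      using assms(1) by (simp add: power_mult)
    then show ?thesis
      by (simp add: zpoint_def power_mult_distrib power_divide divide_inverse power_inverse)
  qed
  then show ?thesis
    unfolding sum_zpoint[OF assms] by (simp add: sum_list_const_mult divide_inverse)
qed

lemmas sum_power4_zpoint = sum_power_zpoint[where m = 2, simplified]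
lemmas sum_power8_zpoint = sum_power_zpoint[where m = 4, simplified]

text \<open>
  The polynomial \<open>(x\<^sub>1\<^sup>2 - \<phi>\<^sup>2 x\<^sub>2\<^sup>2) (x\<^sub>2\<^sup>2 - \<phi>\<^sup>2 x\<^sub>3\<^sup>2) (x\<^sub>3\<^sup>2 - \<phi>\<^sup>2 x\<^sub>1\<^sup>2)\<close>. It vanishes at the vertices of the
  octahedron and of the icosahedron but at no vertex of the cube or the dodecahedron. Being homogeneous, it
  tells points of the sphere apart even if their codes have different lengths.
\<close>
fun zslant :: "zvec \<Rightarrow> zphi" where
  "zslant (a, b, c) = zmul (zsub (zmul a a) (zmul (1, 1) (zmul b b)))
     (zmul (zsub (zmul b b) (zmul (1, 1) (zmul c c))) (zsub (zmul c c) (zmul (1, 1) (zmul a a))))"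

lemma zpoint_disjoint:
  assumes "zval e > 0" "zval e' > 0"
    and "list_all (\<lambda>p. zslant p = (0, 0)) ps" "list_all (\<lambda>p. zslant p \<noteq> (0, 0)) qs"
  shows "zpoint e ` set ps \<inter> zpoint e' ` set qs = {}"
proof -
  define slant :: "real^3 \<Rightarrow> real" where
    "slant x = ((x$1)^2 - golden^2 * (x$2)^2) * (((x$2)^2 - golden^2 * (x$3)^2) * ((x$3)^2 - golden^2 * (x$1)^2))" for x
  have scale: "slant (r *\<^sub>R x) = r^6 * slant x" for r x
    unfolding slant_def by simp algebra
  have val: "slant (zvec_val p) = zval (zslant p)" for p
    by (cases p) (simp del: zmul.simps zsub.simps add: slant_def zvec_val_def zval_simps vector_3 golden_square power2_eq_square[of "zval _"] zval_eval[of 1 1] add.commute)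
  have iff: "slant (zpoint e p) = 0 \<longleftrightarrow> zslant p = (0, 0)" if "zval e > 0" for e p
    using that inj_eq[OF inj_zval, of "zslant p" "(0, 0)"] by (simp add: zpoint_def scale val zval_eval)
  have "slant x = 0" if "x \<in> zpoint e ` set ps" for x
    using that assms(1,3) by (force simp: iff list_all_iff)
  moreover have "slant x \<noteq> 0" if "x \<in> zpoint e' ` set qs" for x
    using that assms(2,4) by (force simp: iff list_all_iff)
  ultimately show ?thesis
    by blast
qed

lemma zslant_codes:
  "list_all (\<lambda>p. zslant p = (0, 0)) octahedron_codes" "list_all (\<lambda>p. zslant p \<noteq> (0, 0)) cube_codes"
  "list_all (\<lambda>p. zslant p = (0, 0)) icosahedron_codes" "list_all (\<lambda>p. zslant p \<noteq> (0, 0)) dodecahedron_codes"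
  by code_simp+

lemma norm_power_3:
  fixes u :: "real^3"
  shows "norm u ^ 2 = (u$1)^2 + (u$2)^2 + (u$3)^2" "norm u ^ 4 = ((u$1)^2 + (u$2)^2 + (u$3)^2)^2"
    "norm u ^ 8 = ((u$1)^2 + (u$2)^2 + (u$3)^2)^4"
proof -
  show *: "norm u ^ 2 = (u$1)^2 + (u$2)^2 + (u$3)^2"
    unfolding power2_norm_eq_inner inner_3 by (simp add: power2_eq_square)
  have "norm u ^ 4 = (norm u ^ 2)^2" "norm u ^ 8 = (norm u ^ 2)^4"
    by (simp_all flip: power_mult)
  then show "norm u ^ 4 = ((u$1)^2 + (u$2)^2 + (u$3)^2)^2" "norm u ^ 8 = ((u$1)^2 + (u$2)^2 + (u$3)^2)^4"
    by (simp_all only: *)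
qed

lemma polytope_vertices_facts:
  assumes "zval e > 0" "spherical_codes e ps" "length ps > 0" "X = zpoint e ` set ps"
  shows "finite X" "X \<noteq> {}" "X \<subseteq> sphere 0 1" "uminus ` X \<subseteq> X" "card X = length ps"
  using zpoint_sphere[OF assms(1,2)] uminus_zpoint[OF assms(1,2)] card_zpoint[OF assms(1,2)] assms(3)
  unfolding assms(4) by auto

lemmas octahedron_facts = polytope_vertices_facts[OF zval_pos(1) spherical_codes(1) _ octahedron_zpoint,
  unfolded length_codes, simplified]
lemmas cube_facts = polytope_vertices_facts[OF zval_pos(3) spherical_codes(2) _ cube_zpoint,
  unfolded length_codes, simplified]
lemmas icosahedron_facts = polytope_vertices_facts[OF zval_pos(5) spherical_codes(4) _ icosahedron_zpoint,
  unfolded length_codes, simplified]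
lemmas dodecahedron_facts = polytope_vertices_facts[OF zval_pos(3) spherical_codes(5) _ dodecahedron_zpoint,
  unfolded length_codes, simplified]

text \<open>
  Each left-hand side is the weighted sum of the vertex mean and the cycle mean of \<open>(u \<bullet> x)\<^sup>8\<close> for
  \<open>u = (a, b, c)\<close>. The factor \<open>(5 - 3 \<phi>) / 25 = 1 / (2 + \<phi>)\<^sup>4\<close> normalizes the icosahedron vertices, and
  \<open>(2 + \<phi>) / 20\<close> the decagon axes; with these numerators the denominators lie in \<open>\<int>\<close>, and the identities
  become statements about polynomials modulo \<open>g\<^sup>2 - g - 1\<close>.
\<close>
lemma icosahedron_identity:
  fixes a b c g :: real
  assumes "g^2 = g + 1"
  defines "N \<equiv> a^2 + b^2 + c^2"
  shows "5/21 / 12 *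
    (2 * (((g*a + b)^8 + (g*a - b)^8 + (g*b + c)^8 + (g*b - c)^8 + (g*c + a)^8 + (g*c - a)^8) * (5 - 3*g) / 25)) +
    (1 - 5/21) * (35/128 * (2 *
      ((N - 4 * ((2+g)/20) * (b + (g-1)*c)^2)^4 + (N - 4 * ((2+g)/20) * (b - (g-1)*c)^2)^4 +
       (N - 4 * ((2+g)/20) * (c + (g-1)*a)^2)^4 + (N - 4 * ((2+g)/20) * (c - (g-1)*a)^2)^4 +
       (N - 4 * ((2+g)/20) * (a + (g-1)*b)^2)^4 + (N - 4 * ((2+g)/20) * (a - (g-1)*b)^2)^4)) / 12)
    = 1/9 * N^4"
  using assms(1) unfolding N_def by algebra

lemma rhombic_triacontahedron_identity:
  fixes a b c g :: real
  assumes "g^2 = g + 1"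
  defines "N \<equiv> a^2 + b^2 + c^2"
  shows "45/49 / 32 *
    (2 * (((g*a + b)^8 + (g*a - b)^8 + (g*b + c)^8 + (g*b - c)^8 + (g*c + a)^8 + (g*c - a)^8) * (5 - 3*g) / 25) +
     2 * ((a + b + c)^8 + (a + b - c)^8 + (a - b + c)^8 + (a - b - c)^8 +
      (g*a + (g-1)*c)^8 + (g*a - (g-1)*c)^8 + (g*b + (g-1)*a)^8 + (g*b - (g-1)*a)^8 +
      (g*c + (g-1)*b)^8 + (g*c - (g-1)*b)^8) / 81) +
    (1 - 45/49) * (35/128 * (2 *
      ((N - 4 * ((2+g)/20) * (b + (g-1)*c)^2)^4 + (N - 4 * ((2+g)/20) * (b - (g-1)*c)^2)^4 +
       (N - 4 * ((2+g)/20) * (c + (g-1)*a)^2)^4 + (N - 4 * ((2+g)/20) * (c - (g-1)*a)^2)^4 +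
       (N - 4 * ((2+g)/20) * (a + (g-1)*b)^2)^4 + (N - 4 * ((2+g)/20) * (a - (g-1)*b)^2)^4)) / 12)
    = 1/9 * N^4"
  using assms(1) unfolding N_def by algebra

section \<open>The four hybrid designs\<close>

lemma octahedron_power4:
  "(\<Sum>x\<in>octahedron_vertices. (u \<bullet> x)^4) = 2 * ((u$1)^4 + (u$2)^4 + (u$3)^4)"
  unfolding octahedron_zpoint sum_power4_zpoint[OF zval_pos(1) spherical_codes(1)]
  by (simp add: octahedron_sum zval_eval)

lemma cuboctahedron_octahedron:
  assumes "induced_cycle cuboctahedron_edges \<gamma>"
  shows "hybrid_design 5 (1/5) \<gamma> octahedron_vertices"
proof -
  note \<gamma> = cuboctahedron_cycle[OF assms]
  have "1/5 / card octahedron_vertices * (\<Sum>x\<in>octahedron_vertices. (u \<bullet> x)^4) +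
      (1 - 1/5) * (cycle_integral \<gamma> (\<lambda>x. (u \<bullet> x)^4) / cycle_length \<gamma>) = 1/5 * norm u ^ 4" for u
    unfolding \<gamma>(3) octahedron_power4 cube_sum[of "\<lambda>y. ((u$1)^2 + (u$2)^2 + (u$3)^2 - y^2 / 3)^2"] norm_power_3 octahedron_facts(5)
    by simp algebra
  from hybrid_designI[OF _ _ \<gamma>(1,2) octahedron_facts(1-4) _ this] show ?thesis
    using \<gamma>(4)[of 5] by simp
qed

lemma cuboctahedron_rhombic_dodecahedron:
  assumes "induced_cycle cuboctahedron_edges \<gamma>"
  shows "hybrid_design 5 (21/25) \<gamma> rhombic_dodecahedron_vertices"
proof -
  note \<gamma> = cuboctahedron_cycle[OF assms]
  let ?X = rhombic_dodecahedron_vertices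
  have disj: "cube_vertices \<inter> octahedron_vertices = {}"
    using zpoint_disjoint[OF zval_pos(1,3) zslant_codes(1,2)]
    by (simp add: octahedron_zpoint cube_zpoint Int_commute)
  have X: "finite ?X" "?X \<noteq> {}" "?X \<subseteq> sphere 0 1" "uminus ` ?X \<subseteq> ?X" "card ?X = 14"
    unfolding rhombic_dodecahedron_vertices_def
    using octahedron_facts cube_facts disj by (auto simp: card_Un_disjoint image_Un)
  have "(\<Sum>x\<in>cube_vertices. (u \<bullet> x)^4) = (\<Sum>p\<leftarrow>cube_codes. (u \<bullet> zvec_val p)^4) / 9" for u
    unfolding cube_zpoint sum_power4_zpoint[OF zval_pos(3) spherical_codes(2)] by (simp add: zval_eval)
  then have sum: "(\<Sum>x\<in>?X. (u \<bullet> x)^4) = (\<Sum>p\<leftarrow>cube_codes. (u \<bullet> zvec_val p)^4) / 9 +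
      2 * ((u$1)^4 + (u$2)^4 + (u$3)^4)" for u
    unfolding rhombic_dodecahedron_vertices_def
    by (simp add: sum.union_disjoint octahedron_facts(1) cube_facts(1) disj octahedron_power4)
  have "21/25 / card ?X * (\<Sum>x\<in>?X. (u \<bullet> x)^4) +
      (1 - 21/25) * (cycle_integral \<gamma> (\<lambda>x. (u \<bullet> x)^4) / cycle_length \<gamma>) = 1/5 * norm u ^ 4" for u
    unfolding \<gamma>(3) sum cube_sum[of "\<lambda>y. ((u$1)^2 + (u$2)^2 + (u$3)^2 - y^2 / 3)^2"] cube_sum[of "\<lambda>y. y^4"] norm_power_3 X(5)
    by simp algebra
  from hybrid_designI[OF _ _ \<gamma>(1,2) X(1-4) _ this] show ?thesis
    using \<gamma>(4)[of 5] by simp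
qed

lemma icosahedron_power8:
  "(\<Sum>x\<in>icosahedron_vertices. (u \<bullet> x)^8) =
    2 * (((golden * u$1 + u$2)^8 + (golden * u$1 - u$2)^8 + (golden * u$2 + u$3)^8 +
      (golden * u$2 - u$3)^8 + (golden * u$3 + u$1)^8 + (golden * u$3 - u$1)^8) * (5 - 3 * golden) / 25)"
proof -
  have "(\<Sum>x\<in>icosahedron_vertices. (u \<bullet> x)^8) = (\<Sum>p\<leftarrow>icosahedron_codes. (u \<bullet> zvec_val p)^8) * (1 / (2 + golden)^4)"
    unfolding icosahedron_zpoint sum_power8_zpoint[OF zval_pos(5) spherical_codes(4)]
    by (simp add: zval_eval)
  then show ?thesis
    unfolding golden_ring_inverses icosahedron_sum by simp
qed

text \<open>
  The constant \<open>1/9\<close> is the mean of \<open>(u \<bullet> x)\<^sup>8\<close> over the sphere for a unit vector \<open>u\<close>; in degree 4 it is \<open>1/5\<close>.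
\<close>
lemma icosidodecahedron_icosahedron:
  assumes "induced_cycle icosidodecahedron_edges \<gamma>"
  shows "hybrid_design 9 (5/21) \<gamma> icosahedron_vertices"
proof -
  note \<gamma> = icosidodecahedron_cycle[OF assms]
  have "5/21 / card icosahedron_vertices * (\<Sum>x\<in>icosahedron_vertices. (u \<bullet> x)^8) +
      (1 - 5/21) * (cycle_integral \<gamma> (\<lambda>x. (u \<bullet> x)^8) / cycle_length \<gamma>) = 1/9 * norm u ^ 8" for u
    using icosahedron_identity[OF golden_square, of "u$1" "u$2" "u$3"]
    unfolding \<gamma>(3) icosahedron_power8 decagon_sum norm_power_3 icosahedron_facts(5)
    by (simp only: of_nat_numeral)
  from hybrid_designI[OF _ _ \<gamma>(1,2) icosahedron_facts(1-4) _ this] show ?thesis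
    using \<gamma>(4)[of 9] by simp
qed

lemma icosidodecahedron_rhombic_triacontahedron:
  assumes "induced_cycle icosidodecahedron_edges \<gamma>"
  shows "hybrid_design 9 (45/49) \<gamma> rhombic_triacontahedron_vertices"
proof -
  note \<gamma> = icosidodecahedron_cycle[OF assms]
  let ?X = rhombic_triacontahedron_vertices
  have disj: "icosahedron_vertices \<inter> dodecahedron_vertices = {}"
    using zpoint_disjoint[OF zval_pos(5,3) zslant_codes(3,4)]
    by (simp add: icosahedron_zpoint dodecahedron_zpoint)
  have X: "finite ?X" "?X \<noteq> {}" "?X \<subseteq> sphere 0 1" "uminus ` ?X \<subseteq> ?X" "card ?X = 32"
    unfolding rhombic_triacontahedron_vertices_def
    using icosahedron_facts dodecahedron_facts disj by (auto simp: card_Un_disjoint image_Un)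
  have "(\<Sum>x\<in>dodecahedron_vertices. (u \<bullet> x)^8) = (\<Sum>p\<leftarrow>dodecahedron_codes. (u \<bullet> zvec_val p)^8) / 81" for u
    unfolding dodecahedron_zpoint sum_power8_zpoint[OF zval_pos(3) spherical_codes(5)] by (simp add: zval_eval)
  then have sum: "(\<Sum>x\<in>?X. (u \<bullet> x)^8) = (\<Sum>x\<in>icosahedron_vertices. (u \<bullet> x)^8) +
      (\<Sum>p\<leftarrow>dodecahedron_codes. (u \<bullet> zvec_val p)^8) / 81" for u
    unfolding rhombic_triacontahedron_vertices_def
    by (simp add: sum.union_disjoint icosahedron_facts(1) dodecahedron_facts(1) disj)
  have "45/49 / card ?X * (\<Sum>x\<in>?X. (u \<bullet> x)^8) +
      (1 - 45/49) * (cycle_integral \<gamma> (\<lambda>x. (u \<bullet> x)^8) / cycle_length \<gamma>) = 1/9 * norm u ^ 8" for u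
    using rhombic_triacontahedron_identity[OF golden_square, of "u$1" "u$2" "u$3"]
    unfolding \<gamma>(3) sum icosahedron_power8 dodecahedron_sum decagon_sum norm_power_3 X(5)
    by (simp only: of_nat_numeral)
  from hybrid_designI[OF _ _ \<gamma>(1,2) X(1-4) _ this] show ?thesis
    using \<gamma>(4)[of 9] by simp
qed

theorem corollary7p3:
  fixes \<gamma> :: "(real^3) list"
  shows "(induced_cycle cuboctahedron_edges \<gamma> \<longrightarrow>
            hybrid_design 5 (21/25) \<gamma> rhombic_dodecahedron_vertices) \<and>
         (induced_cycle cuboctahedron_edges \<gamma> \<longrightarrow>
            hybrid_design 5 (1/5) \<gamma> octahedron_vertices) \<and>
         (induced_cycle icosidodecahedron_edges \<gamma> \<longrightarrow>
            hybrid_design 9 (45/49) \<gamma> rhombic_triacontahedron_vertices) \<and>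
         (induced_cycle icosidodecahedron_edges \<gamma> \<longrightarrow>
            hybrid_design 9 (5/21) \<gamma> icosahedron_vertices)"
  using cuboctahedron_rhombic_dodecahedron cuboctahedron_octahedron
    icosidodecahedron_rhombic_triacontahedron icosidodecahedron_icosahedron by blast

end
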